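(* Let $n-1\ge 2$, let $W\subset\mathbb{R}^N$ be a smooth compact semi-algebraic embedded submanifold without boundary, of dimension $n-1$, and let $F=(f_1,f_2):\mathbb{R}^N\to\mathbb{R}^2$ be a $C^2$ semi-algebraic map satisfying Conditions (a) and (b). Let $M_F$ be the fiber of the locally trivial fibration $\bar F:W\setminus V_W(F)\to S^1$, and let $M_{f_1}^+=\{f_1>0\}\cap W$ and $M_{f_1}^-=\{f_1<0\}\cap W$. Then $M_F$ is homotopy equivalent to $M_{f_1}^+$ and to $M_{f_1}^-$.
   Context: Notation: $V(F)=F^{-1}(0)$, $V_W(F)=V(F)\cap W$, $\bar F=F/\|F\|:\mathbb{R}^N\setminus V(F)\to S^1$ (Euclidean norm). $\Sigma_F^W\subset W$ is the set of critical points of $F_{|W}$ (differential of rank $<2$), and $\Sigma_{\bar F}^W\subset W\setminus V_W(F)$ is the set of critical points of $\bar F_{|W\setminus V_W(F)}$ (differential of rank $<1$). Condition (a): $\overline{\Sigma_F^W\setminus V_W(F)}\cap V_W(F)=\emptyset$. Condition (b): $\Sigma_{\bar F}^W=\emptyset$. Under these conditions $\bar F:W\setminus V_W(F)\to S^1$ is a $C^2$ locally trivial fibration (the fibre possibly empty), whose fiber is well defined up to diffeomorphism; one may take $M_F=\{f_1>0,\ f_2=0\}\cap W$. *)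

theory Defs
  imports "HOL-Analysis.Analysis"
begin

(* The smallest Boolean algebra of sets containing all {p > 0} with p polynomial. *)
inductive semialgebraic :: "'a::euclidean_space set \<Rightarrow> bool" where
  pos: "real_polynomial_function p \<Longrightarrow> semialgebraic {x. p x > 0}"
| compl: "semialgebraic A \<Longrightarrow> semialgebraic (- A)"
| inter: "semialgebraic A \<Longrightarrow> semialgebraic B \<Longrightarrow> semialgebraic (A \<inter> B)"

definition semialgebraic_map :: "('a::euclidean_space \<Rightarrow> 'b::euclidean_space) \<Rightarrow> bool" where
  "semialgebraic_map f \<longleftrightarrow> semialgebraic {(x, f x) | x. True}"

(* Meant for open U.  Recursing through directional derivatives keeps the codomain fixed;
   in finite dimension this is the usual C^k. *)
primrec Ck_on :: "nat \<Rightarrow> 'a set \<Rightarrow> ('a::euclidean_space \<Rightarrow> 'b::euclidean_space) \<Rightarrow> bool" where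
  "Ck_on 0 U f \<longleftrightarrow> continuous_on U f"
| "Ck_on (Suc k) U f \<longleftrightarrow>
     f differentiable_on U \<and> (\<forall>v. Ck_on k U (\<lambda>x. frechet_derivative f (at x) v))"

definition smooth_on :: "'a set \<Rightarrow> ('a::euclidean_space \<Rightarrow> 'b::euclidean_space) \<Rightarrow> bool" where
  "smooth_on U f \<longleftrightarrow> (\<forall>k. Ck_on k U f)"

(* Embedded C^infinity submanifold without boundary, by slice charts. *)
definition smooth_submanifold :: "nat \<Rightarrow> 'a::euclidean_space set \<Rightarrow> bool" where
  "smooth_submanifold d W \<longleftrightarrow>
     (\<forall>x\<in>W. \<exists>U V (\<phi> :: 'a \<Rightarrow> 'a) \<psi> L.
        open U \<and> x \<in> U \<and> open V \<and> homeomorphism U V \<phi> \<psi> \<and>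
        smooth_on U \<phi> \<and> smooth_on V \<psi> \<and>
        subspace L \<and> dim L = d \<and> \<phi> ` (U \<inter> W) = V \<inter> L)"

definition tangent_space :: "'a::euclidean_space set \<Rightarrow> 'a \<Rightarrow> 'a set" where
  "tangent_space W x =
     {v. \<exists>e>0. \<exists>\<gamma> :: real \<Rightarrow> 'a. smooth_on {-e<..<e} \<gamma> \<and> \<gamma> ` {-e<..<e} \<subseteq> W \<and>
           \<gamma> 0 = x \<and> (\<gamma> has_vector_derivative v) (at 0)}"

(* Rank of the differential at x of the restriction of f to the submanifold W;
   f has to be differentiable at x in the ambient space. *)
definition rank_on :: "'a::euclidean_space set \<Rightarrow> ('a \<Rightarrow> 'b::euclidean_space) \<Rightarrow> 'a \<Rightarrow> nat" where
  "rank_on W f x = dim (frechet_derivative f (at x) ` tangent_space W x)"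

definition zeros_in :: "'a set \<Rightarrow> ('a \<Rightarrow> real \<times> real) \<Rightarrow> 'a set" where
  "zeros_in W F = {x \<in> W. F x = 0}"

(* F / ||F||; the norm of real \<times> real is the Euclidean one.  Only used off the zeros of F. *)
definition unit_map :: "('a \<Rightarrow> real \<times> real) \<Rightarrow> 'a \<Rightarrow> real \<times> real" where
  "unit_map F x = F x /\<^sub>R norm (F x)"

definition crit_F :: "'a::euclidean_space set \<Rightarrow> ('a \<Rightarrow> real \<times> real) \<Rightarrow> 'a set" where
  "crit_F W F = {x \<in> W. rank_on W F x < 2}"

(* The values of F / ||F|| lie on the circle, so the rank of its differential is the same
   whether the codomain is the circle or the plane. *)
definition crit_unit_map :: "'a::euclidean_space set \<Rightarrow> ('a \<Rightarrow> real \<times> real) \<Rightarrow> 'a set" where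
  "crit_unit_map W F =
     {x \<in> W - zeros_in W F. rank_on (W - zeros_in W F) (unit_map F) x < 1}"

definition condition_a :: "'a::euclidean_space set \<Rightarrow> ('a \<Rightarrow> real \<times> real) \<Rightarrow> bool" where
  "condition_a W F \<longleftrightarrow> closure (crit_F W F - zeros_in W F) \<inter> zeros_in W F = {}"

definition condition_b :: "'a::euclidean_space set \<Rightarrow> ('a \<Rightarrow> real \<times> real) \<Rightarrow> bool" where
  "condition_b W F \<longleftrightarrow> crit_unit_map W F = {}"

definition fiber :: "'a set \<Rightarrow> ('a \<Rightarrow> real \<times> real) \<Rightarrow> real \<times> real \<Rightarrow> 'a set" where
  "fiber W F c = {x \<in> W - zeros_in W F. unit_map F x = c}"

end

theory Submission
  imports Defs
begin

text \<open>
  The set \<open>{x \<in> W. f1 x > 0}\<close> lies over an open half circle of directions of \<open>F\<close>, and it is deformed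
  onto the fibre of \<open>F / norm F\<close> over the centre of this arc by turning the direction of \<open>F\<close> back to the
  centre.  Turning around the whole circle compares the fibres with each other, and the
  same argument applies to \<open>f1 < 0\<close>.  All that is needed is a continuous motion of \<open>X\<close>, the part of \<open>W\<close>
  where \<open>F\<close> does not vanish, which turns the direction of \<open>F\<close> at unit speed and starts at the identity.

  Such a motion is usually the flow of a vector field.  Here no differential equation is solved,
  and the motion is not required to be a flow; it is only a lift in the sense of the predicate
  \<open>is_lift\<close>.  This is enough for the homotopy equivalences (\<open>homotopy_eqv_rotated_fibre\<close> and
  \<open>homotopy_eqv_arc\<close>), and lifts can be constructed from local ones by purely topological means:
  \<open>patch_lifts\<close> combines finitely many local lifts over a compact set by performing them one after
  the other, \<open>extend_lift\<close> doubles the time, and \<open>glue_lifts\<close> passes from compact sets to all of \<open>X\<close>.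

  Local lifts come from the inverse function theorem in a chart of \<open>W\<close> (\<open>local_sections\<close>).
  Condition (b) provides them at every point of \<open>X\<close>.  The danger is that the motion runs into the
  zeros of \<open>F\<close>, and Condition (a) excludes this: close to the zeros \<open>F\<close> is a submersion on \<open>W\<close>, so its
  direction can be turned while its norm is kept fixed.  Hence the truncated norm \<open>min (norm F) (\<delta> / 2)\<close>
  is constant along the motion for a suitable \<open>\<delta>\<close>, and its superlevel sets are an exhaustion of \<open>X\<close> by
  invariant compact sets.
\<close>

section \<open>Rotations of the plane\<close>

definition rot :: "real \<Rightarrow> real \<times> real \<Rightarrow> real \<times> real" where
  "rot t p = (cos t * fst p - sin t * snd p, sin t * fst p + cos t * snd p)"

lemma rot_0 [simp]: "rot 0 p = p"
  by (simp add: rot_def)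

lemma rot_rot [simp]: "rot s (rot t p) = rot (s + t) p"
  by (simp add: rot_def sin_add cos_add algebra_simps)

lemma rot_scaleR: "rot t (r *\<^sub>R p) = r *\<^sub>R rot t p"
  by (simp add: rot_def algebra_simps)

lemma norm_rot [simp]: "norm (rot t p) = norm p"
proof -
  have "(cos t * a - sin t * b)\<^sup>2 + (sin t * a + cos t * b)\<^sup>2 = ((sin t)\<^sup>2 + (cos t)\<^sup>2) * (a\<^sup>2 + b\<^sup>2)" for a b
    by algebra
  then show ?thesis
    by (cases p) (simp add: rot_def norm_Pair)
qed

lemma continuous_on_rot [continuous_intros]:
  fixes f :: "'a::t2_space \<Rightarrow> real"
  assumes "continuous_on S f" "continuous_on S g"
  shows "continuous_on S (\<lambda>x. rot (f x) (g x))"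
  unfolding rot_def using assms by (intro continuous_intros)

lemma ex_rot:
  assumes "norm c = 1"
  obtains t where "\<bar>t\<bar> \<le> 2 * pi" "c = rot t (1, 0)"
proof -
  obtain a b where c: "c = (a, b)"
    by fastforce
  have "a\<^sup>2 + b\<^sup>2 = 1"
    using assms by (simp add: c norm_Pair)
  then obtain t where "0 \<le> t" "t < 2 * pi" "a = cos t" "b = sin t"
    using sincos_total_2pi by blast
  then show thesis
    by (intro that[of t]) (simp_all add: c rot_def)
qed

section \<open>Lifting rotations of the circle\<close>

text \<open>
  A lift moves the points of \<open>A\<close> inside \<open>X\<close> so that \<open>q\<close>, a map to the circle, turns at unit
  speed.  It is a substitute for the flow of a vector field lifting the rotation of the circle:
  the value at time \<open>0\<close> is the identity, but no group law is asked for, which is what makes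
  such maps easy to construct.  Constancy of \<open>m\<close> is what will keep the motion inside
  compact subsets of \<open>X\<close>.
\<close>

definition is_lift ::
  "'a::metric_space set \<Rightarrow> ('a \<Rightarrow> real \<times> real) \<Rightarrow> ('a \<Rightarrow> real) \<Rightarrow> 'a set \<Rightarrow> real \<Rightarrow> ('a \<times> real \<Rightarrow> 'a) \<Rightarrow> bool"
  where "is_lift X q m A \<epsilon> \<phi> \<longleftrightarrow>
    continuous_on (A \<times> {-\<epsilon>..\<epsilon>}) \<phi> \<and>
    (\<forall>x\<in>A. \<phi> (x, 0) = x \<and>
      (\<forall>t\<in>{-\<epsilon>..\<epsilon>}. \<phi> (x, t) \<in> X \<and> q (\<phi> (x, t)) = rot t (q x) \<and> m (\<phi> (x, t)) = m x))"

lemma is_liftD: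
  assumes "is_lift X q m A \<epsilon> \<phi>"
  shows "continuous_on (A \<times> {-\<epsilon>..\<epsilon>}) \<phi>"
    and "x \<in> A \<Longrightarrow> \<phi> (x, 0) = x"
    and "\<lbrakk>x \<in> A; \<bar>t\<bar> \<le> \<epsilon>\<rbrakk> \<Longrightarrow> \<phi> (x, t) \<in> X"
    and "\<lbrakk>x \<in> A; \<bar>t\<bar> \<le> \<epsilon>\<rbrakk> \<Longrightarrow> q (\<phi> (x, t)) = rot t (q x)"
    and "\<lbrakk>x \<in> A; \<bar>t\<bar> \<le> \<epsilon>\<rbrakk> \<Longrightarrow> m (\<phi> (x, t)) = m x"
  using assms unfolding is_lift_def by (auto simp: abs_le_iff)

lemma is_liftI:
  assumes "continuous_on (A \<times> {-\<epsilon>..\<epsilon>}) \<phi>"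
    and "\<And>x. x \<in> A \<Longrightarrow> \<phi> (x, 0) = x"
    and "\<And>x t. \<lbrakk>x \<in> A; \<bar>t\<bar> \<le> \<epsilon>\<rbrakk> \<Longrightarrow> \<phi> (x, t) \<in> X"
    and "\<And>x t. \<lbrakk>x \<in> A; \<bar>t\<bar> \<le> \<epsilon>\<rbrakk> \<Longrightarrow> q (\<phi> (x, t)) = rot t (q x)"
    and "\<And>x t. \<lbrakk>x \<in> A; \<bar>t\<bar> \<le> \<epsilon>\<rbrakk> \<Longrightarrow> m (\<phi> (x, t)) = m x"
  shows "is_lift X q m A \<epsilon> \<phi>"
  using assms unfolding is_lift_def by (auto simp: abs_le_iff)

lemma is_lift_mono:
  assumes "is_lift X q m A \<epsilon> \<phi>" "B \<subseteq> A" "\<delta> \<le> \<epsilon>"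
  shows "is_lift X q m B \<delta> \<phi>"
proof (rule is_liftI)
  show "continuous_on (B \<times> {-\<delta>..\<delta>}) \<phi>"
    by (rule continuous_on_subset[OF is_liftD(1)[OF assms(1)]]) (use assms in auto)
qed (use assms is_liftD[OF assms(1)] in auto)

text \<open>
  Local lifts combine by splitting the time instead of averaging velocities.  With a partition of
  unity \<open>l c\<close> subordinate to a finite cover, the point \<open>x\<close> is moved successively by each local
  lift \<open>\<phi> c\<close> for the time \<open>t * l c x\<close>; the angles add up to \<open>t\<close>.  For small \<open>t\<close> the intermediate
  points stay so close to \<open>x\<close> that they remain in the domain of the next local lift whenever that
  lift has to be used.
\<close>

lemma patch_lifts:
  fixes X :: "'a::metric_space set"
  assumes "compact K" "K \<subseteq> X"
    and sat: "\<And>x y. \<lbrakk>x \<in> K; y \<in> X; m y = m x\<rbrakk> \<Longrightarrow> y \<in> K"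
    and loc: "\<And>x. x \<in> K \<Longrightarrow> \<exists>r>0. \<exists>\<epsilon>>0. \<exists>\<phi>. is_lift X q m (X \<inter> ball x r) \<epsilon> \<phi>"
  shows "\<exists>\<epsilon>>0. \<exists>\<phi>. is_lift X q m K \<epsilon> \<phi>"
proof -
  have "\<forall>x\<in>K. \<exists>r \<epsilon> \<phi>. r > 0 \<and> \<epsilon> > 0 \<and> is_lift X q m (X \<inter> ball x r) \<epsilon> \<phi>"
    using loc by blast
  then obtain R e \<phi> where R: "\<And>x. x \<in> K \<Longrightarrow> R x > 0" and e: "\<And>x. x \<in> K \<Longrightarrow> e x > 0"
    and \<phi>: "\<And>x. x \<in> K \<Longrightarrow> is_lift X q m (X \<inter> ball x (R x)) (e x) (\<phi> x)"
    by metis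
  \<comment> \<open>The domains have radius \<open>3 * r\<close>, and the weights live on radius \<open>r\<close>, which leaves room for a drift of size \<open>r\<close>.\<close>
  define r where "r x = R x / 3" for x
  have r: "r x > 0" if "x \<in> K" for x
    using R[OF that] by (simp add: r_def)
  obtain C where C: "C \<subseteq> K" "finite C" "K \<subseteq> (\<Union>c\<in>C. ball c (r c))"
  proof (rule compactE_image[OF assms(1)])
    show "K \<subseteq> (\<Union>c\<in>K. ball c (r c))"
      using r by force
  qed (auto intro: that)
  define b where "b c x = max 0 (r c - dist c x)" for c x
  define \<Lambda> where "\<Lambda> x = (\<Sum>c\<in>C. b c x)" for x
  define l where "l c x = b c x / \<Lambda> x" for c x
  have b0: "b c x \<ge> 0" for c x
    by (simp add: b_def)
  have \<Lambda>: "\<Lambda> x > 0" if x: "x \<in> K" for x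
  proof -
    obtain c where "c \<in> C" "x \<in> ball c (r c)"
      using C x by blast
    then have "b c x > 0"
      by (simp add: b_def)
    then show ?thesis
      unfolding \<Lambda>_def using C(2) \<open>c \<in> C\<close> b0 by (intro sum_pos2)
  qed
  have l01: "0 \<le> l c x" "l c x \<le> 1" if "x \<in> K" "c \<in> C" for c x
  proof -
    show "0 \<le> l c x"
      using \<Lambda>[OF that(1)] b0 by (simp add: l_def)
    have "b c x \<le> \<Lambda> x"
      unfolding \<Lambda>_def using C(2) that b0 by (intro member_le_sum)
    then show "l c x \<le> 1"
      using \<Lambda>[OF that(1)] by (simp add: l_def)
  qed
  have cont_l: "continuous_on K (l c)" for c
    unfolding l_def \<Lambda>_def b_def
    using \<Lambda> by (intro continuous_intros) (force simp: \<Lambda>_def b_def)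
  have suml: "(\<Sum>c\<in>C. l c x) = 1" if "x \<in> K" for x
    using \<Lambda>[OF that] by (simp add: l_def \<Lambda>_def flip: sum_divide_distrib)
  have "\<exists>\<epsilon>>0. \<exists>g. continuous_on (K \<times> {-\<epsilon>..\<epsilon>}) g \<and>
      (\<forall>x\<in>K. g (x, 0) = x \<and> (\<forall>t\<in>{-\<epsilon>..\<epsilon>}. g (x, t) \<in> K \<and>
         q (g (x, t)) = rot (t * (\<Sum>c\<in>D. l c x)) (q x) \<and> m (g (x, t)) = m x))"
    if "finite D" "D \<subseteq> C" for D
    using that
  proof (induction D)
    case empty
    have "continuous_on (K \<times> {-1..1}) (fst :: 'a \<times> real \<Rightarrow> 'a)"
      by (intro continuous_intros)
    then show ?case
      by (intro exI[of _ "1::real"] conjI exI[of _ fst]) auto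
  next
    case (insert c D)
    then have c: "c \<in> C" "c \<in> K" "D \<subseteq> C"
      using C by auto
    obtain \<epsilon> g where \<epsilon>: "\<epsilon> > 0" and contg: "continuous_on (K \<times> {-\<epsilon>..\<epsilon>}) g"
      and g0: "\<And>x. x \<in> K \<Longrightarrow> g (x, 0) = x"
      and g: "\<And>x t. \<lbrakk>x \<in> K; \<bar>t\<bar> \<le> \<epsilon>\<rbrakk> \<Longrightarrow> g (x, t) \<in> K \<and>
         q (g (x, t)) = rot (t * (\<Sum>c\<in>D. l c x)) (q x) \<and> m (g (x, t)) = m x"
      using insert.IH[OF c(3)] by (auto simp: abs_le_iff)
    have "uniformly_continuous_on (K \<times> {-\<epsilon>..\<epsilon>}) g"
      by (intro compact_uniformly_continuous contg compact_Times assms) auto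
    then obtain d where d: "d > 0"
      and gd: "\<And>z z'. \<lbrakk>z \<in> K \<times> {-\<epsilon>..\<epsilon>}; z' \<in> K \<times> {-\<epsilon>..\<epsilon>}; dist z' z < d\<rbrakk> \<Longrightarrow> dist (g z') (g z) < r c"
      unfolding uniformly_continuous_on_def using r[OF c(2)] by metis
    define \<epsilon>' where "\<epsilon>' = Min {\<epsilon>, d / 2, e c}"
    have \<epsilon>': "\<epsilon>' > 0" "\<epsilon>' \<le> \<epsilon>" "\<epsilon>' < d" "\<epsilon>' \<le> e c"
      using \<epsilon> d e[OF c(2)] by (auto simp: \<epsilon>'_def min_def)
    have near: "dist (g (x, t)) x < r c" if "x \<in> K" "\<bar>t\<bar> \<le> \<epsilon>'" for x t
      using gd[of "(x, 0)" "(x, t)"] that \<epsilon>' \<epsilon> g0[of x]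
      by (auto simp: dist_Pair_Pair dist_real_def abs_le_iff)
    have box: "(g (x, t), t * l c x) \<in> (X \<inter> ball c (R c)) \<times> {- e c..e c}"
      if "x \<in> K" "\<bar>t\<bar> \<le> \<epsilon>'" "dist c x \<le> r c" for x t
    proof -
      have "dist c (g (x, t)) < R c"
        using near[OF that(1,2)] dist_triangle[of c "g (x, t)" x] that(3) r[OF c(2)]
        by (simp add: r_def dist_commute)
      moreover have "\<bar>t * l c x\<bar> \<le> \<epsilon>'"
        using l01[OF that(1) c(1)] that(2) mult_mono[of "\<bar>t\<bar>" \<epsilon>' "l c x" 1] \<epsilon>' by (simp add: abs_mult)
      ultimately show ?thesis
        using g[of x t] that \<epsilon>' assms(2) by (auto simp: abs_le_iff)
    qed
    note lift = is_liftD[OF \<phi>[OF c(2)]]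
    have far: "l c x = 0" if "dist c x \<ge> r c" for x
      using that by (simp add: l_def b_def)
    \<comment> \<open>On the sphere \<open>dist c x = r c\<close> the weight vanishes, so that the two cases agree there.\<close>
    define h where "h z = (if dist c (fst z) \<le> r c then \<phi> c (g z, snd z * l c (fst z)) else g z)" for z
    have h: "h (x, t) \<in> K \<and> q (h (x, t)) = rot (t * (\<Sum>c\<in>insert c D. l c x)) (q x) \<and> m (h (x, t)) = m x"
      if "x \<in> K" "\<bar>t\<bar> \<le> \<epsilon>'" for x t
    proof (cases "dist c x \<le> r c")
      case True
      have 1: "g (x, t) \<in> X \<inter> ball c (R c)" "\<bar>t * l c x\<bar> \<le> e c"
        using box[OF that True] by auto
      have 2: "\<bar>t\<bar> \<le> \<epsilon>"
        using that \<epsilon>' by simp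
      show ?thesis
        using lift(3-5)[OF 1] g[OF that(1) 2] insert.hyps True sat[of x "h (x, t)"] that(1)
        by (auto simp: h_def algebra_simps)
    next
      case False
      then show ?thesis
        using g[of x t] that \<epsilon>' far[of x] insert.hyps by (auto simp: h_def)
    qed
    have h0: "h (x, 0) = x" if "x \<in> K" for x
    proof (cases "dist c x \<le> r c")
      case True
      then have "x \<in> X \<inter> ball c (R c)"
        using box[of x 0] that g0[OF that] \<epsilon>' by auto
      then show ?thesis
        using True lift(2) g0[OF that] by (simp add: h_def)
    qed (use g0 that in \<open>simp add: h_def\<close>)
    let ?Z = "K \<times> {-\<epsilon>'..\<epsilon>'}"
    let ?S = "{z \<in> ?Z. dist c (fst z) \<le> r c}" and ?S' = "{z \<in> ?Z. dist c (fst z) \<ge> r c}"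
    have Z: "?S \<union> ?S' = ?Z"
      by auto
    have contg': "continuous_on ?Z g"
      by (rule continuous_on_subset[OF contg]) (use \<epsilon>' in auto)
    have "continuous_on (?S \<union> ?S') h"
      unfolding h_def
    proof (rule continuous_on_cases_local)
      have contd: "continuous_on ?Z (\<lambda>z. dist c (fst z))"
        by (intro continuous_intros)
      have "?S = ?Z \<inter> (\<lambda>z. dist c (fst z)) -` {..r c}"
        by auto
      with continuous_closedin_preimage[OF contd closed_atMost[of "r c"]]
      show "closedin (top_of_set (?S \<union> ?S')) ?S"
        unfolding Z by (simp only:)
      have "?S' = ?Z \<inter> (\<lambda>z. dist c (fst z)) -` {r c..}"
        by auto
      with continuous_closedin_preimage[OF contd closed_atLeast[of "r c"]]
      show "closedin (top_of_set (?S \<union> ?S')) ?S'"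
        unfolding Z by (simp only:)
      have "continuous_on ?S (\<lambda>z. (g z, snd z * l c (fst z)))"
        by (intro continuous_intros continuous_on_subset[OF contg']
            continuous_on_compose2[OF cont_l continuous_on_fst[OF continuous_on_id]]) auto
      moreover have "(\<lambda>z. (g z, snd z * l c (fst z))) ` ?S \<subseteq> (X \<inter> ball c (R c)) \<times> {- e c..e c}"
        using box by (auto simp: abs_le_iff)
      ultimately show "continuous_on ?S (\<lambda>z. \<phi> c (g z, snd z * l c (fst z)))"
        by (rule continuous_on_compose2[OF lift(1)])
      show "continuous_on ?S' g"
        by (rule continuous_on_subset[OF contg']) auto
      fix z assume "z \<in> ?S \<and> \<not> dist c (fst z) \<le> r c \<or> z \<in> ?S' \<and> dist c (fst z) \<le> r c"
      then have z: "z \<in> ?Z" "dist c (fst z) = r c"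
        by auto
      then show "\<phi> c (g z, snd z * l c (fst z)) = g z"
        using box[of "fst z" "snd z"] far[of "fst z"] lift(2)[of "g z"] by (auto simp: abs_le_iff)
    qed
    then have "continuous_on ?Z h"
      unfolding Z .
    then show ?case
      using \<epsilon>'(1) h h0 by (intro exI[of _ \<epsilon>'] exI[of _ h] conjI) (auto simp: abs_le_iff)
  qed
  from this[OF C(2) subset_refl] obtain \<epsilon> g where "\<epsilon> > 0" "continuous_on (K \<times> {-\<epsilon>..\<epsilon>}) g"
      "\<forall>x\<in>K. g (x, 0) = x \<and> (\<forall>t\<in>{-\<epsilon>..\<epsilon>}. g (x, t) \<in> K \<and>
         q (g (x, t)) = rot (t * (\<Sum>c\<in>C. l c x)) (q x) \<and> m (g (x, t)) = m x)"
    by blast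
  then have "is_lift X q m K \<epsilon> g"
    using suml assms(2) by (auto simp: is_lift_def)
  then show ?thesis
    using \<open>\<epsilon> > 0\<close> by blast
qed

text \<open>
  The weights \<open>a\<close> and \<open>b\<close> may depend on the point: they only reparametrize the time of each of the
  two moves, and the angles still add up to \<open>t\<close>.
\<close>

lemma compose_lifts:
  assumes f: "is_lift X q m A \<epsilon> f" and g: "is_lift X q m B \<delta> g"
    and C: "C \<subseteq> A" "continuous_on C a" "continuous_on C b"
    and ab: "\<And>x t. \<lbrakk>x \<in> C; \<bar>t\<bar> \<le> T\<rbrakk> \<Longrightarrow> \<bar>a x * t\<bar> \<le> \<epsilon> \<and> \<bar>b x * t\<bar> \<le> \<delta> \<and> f (x, a x * t) \<in> B"
    and sum: "\<And>x. x \<in> C \<Longrightarrow> a x + b x = 1"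
    and T: "T \<ge> 0"
  shows "is_lift X q m C T (\<lambda>(x, t). g (f (x, a x * t), b x * t))"
proof (rule is_liftI)
  have ab': "a x * t \<in> {-\<epsilon>..\<epsilon>}" "b x * t \<in> {-\<delta>..\<delta>}" "f (x, a x * t) \<in> B"
    if "x \<in> C" "t \<in> {-T..T}" for x t
    using ab[of x t] that by (auto simp: abs_le_iff)
  have 1: "continuous_on (C \<times> {-T..T}) (\<lambda>z. a (fst z))" "continuous_on (C \<times> {-T..T}) (\<lambda>z. b (fst z))"
    by (rule continuous_on_compose2[OF C(2)] continuous_on_compose2[OF C(3)]; force intro: continuous_intros)+
  have 2: "continuous_on (C \<times> {-T..T}) (\<lambda>z. f (fst z, a (fst z) * snd z))"
    by (rule continuous_on_compose2[OF is_liftD(1)[OF f]])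
      (use ab' C(1) in \<open>force intro!: continuous_intros 1\<close>)+
  have "continuous_on (C \<times> {-T..T}) (\<lambda>z. g (f (fst z, a (fst z) * snd z), b (fst z) * snd z))"
    by (rule continuous_on_compose2[OF is_liftD(1)[OF g]])
      (use ab' in \<open>force intro!: continuous_intros 1 2\<close>)+
  then show "continuous_on (C \<times> {-T..T}) (\<lambda>(x, t). g (f (x, a x * t), b x * t))"
    by (simp add: case_prod_unfold)
next
  fix x t assume x: "x \<in> C" and t: "\<bar>t\<bar> \<le> T"
  have "x \<in> A"
    using C x by blast
  note ab = ab[OF x t]
  note f = is_liftD(4,5)[OF f \<open>x \<in> A\<close> ab[THEN conjunct1]]
  note g = is_liftD(3-5)[OF g ab[THEN conjunct2, THEN conjunct2] ab[THEN conjunct2, THEN conjunct1]]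
  have "b x * t + a x * t = t"
    using sum[OF x] by (simp add: add.commute flip: distrib_right)
  with f g show "(case (x, t) of (x, t) \<Rightarrow> g (f (x, a x * t), b x * t)) \<in> X"
    "q (case (x, t) of (x, t) \<Rightarrow> g (f (x, a x * t), b x * t)) = rot t (q x)"
    "m (case (x, t) of (x, t) \<Rightarrow> g (f (x, a x * t), b x * t)) = m x"
    by auto
next
  fix x assume x: "x \<in> C"
  then show "(case (x, 0) of (x, t) \<Rightarrow> g (f (x, a x * t), b x * t)) = x"
    using ab[OF x, of 0] T C(1) is_liftD(2)[OF f, of x] is_liftD(2)[OF g, of x] by auto
qed

text \<open>
  A saturated set is mapped to itself, so a lift can be performed twice in a row for half of the
  time; this doubles the time for which it is defined.
\<close>

lemma extend_lift:
  assumes sat: "\<And>x y. \<lbrakk>x \<in> K; y \<in> X; m y = m x\<rbrakk> \<Longrightarrow> y \<in> K"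
    and "\<epsilon> > 0" "is_lift X q m K \<epsilon> \<phi>"
  shows "\<exists>\<psi>. is_lift X q m K T \<psi>"
proof -
  have "\<exists>\<psi>. is_lift X q m K (2 ^ n * \<epsilon>) \<psi>" for n :: nat
  proof (induction n)
    case (Suc n)
    then obtain \<psi> where \<psi>: "is_lift X q m K (2 ^ n * \<epsilon>) \<psi>"
      by blast
    have "is_lift X q m K (2 ^ Suc n * \<epsilon>) (\<lambda>(x, t). \<psi> (\<psi> (x, 1 / 2 * t), 1 / 2 * t))"
    proof (rule compose_lifts[OF \<psi> \<psi>, of K "\<lambda>_. 1 / 2" "\<lambda>_. 1 / 2"])
      fix x t assume x: "x \<in> K" and "\<bar>t\<bar> \<le> 2 ^ Suc n * \<epsilon>"
      then have t: "\<bar>1 / 2 * t\<bar> \<le> 2 ^ n * \<epsilon>"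
        by simp
      then show "\<bar>1 / 2 * t\<bar> \<le> 2 ^ n * \<epsilon> \<and> \<bar>1 / 2 * t\<bar> \<le> 2 ^ n * \<epsilon> \<and> \<psi> (x, 1 / 2 * t) \<in> K"
        using is_liftD(3,5)[OF \<psi> x t] sat[OF x] by blast
    qed (use assms(2) in \<open>auto intro: continuous_intros\<close>)
    then show ?case
      by blast
  qed (use assms in auto)
  moreover obtain n where "T / \<epsilon> < 2 ^ n"
    using real_arch_pow[of 2 "T / \<epsilon>"] by auto
  then have "T \<le> 2 ^ n * \<epsilon>"
    using assms(2) by (simp add: field_simps)
  ultimately show ?thesis
    using is_lift_mono[OF _ subset_refl] by blast
qed

text \<open>
  The sets \<open>m \<ge> \<eta>\<close> exhaust \<open>X\<close>, but the lifts on them need not agree.  Put \<open>u = 1 / m\<close>.  On the layer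
  \<open>n \<le> u \<le> n + 1\<close> one interpolates from the \<open>n\<close>-th lift to the next one by moving first along the
  \<open>n\<close>-th lift for the fraction \<open>n + 1 - u\<close> of the time and then along the next one for the fraction
  \<open>u - n\<close>.  This is legitimate because \<open>u\<close> does not change during the motion, and on the
  boundary of a layer only one of the two moves is left.
\<close>

lemma glue_lifts:
  fixes X :: "'a::metric_space set"
  assumes contm: "continuous_on X m" and pos: "\<And>x. x \<in> X \<Longrightarrow> m x > 0" and T: "T \<ge> 0"
    and ex: "\<And>\<eta>. \<eta> > 0 \<Longrightarrow> \<exists>\<phi>. is_lift X q m {x \<in> X. m x \<ge> \<eta>} T \<phi>"
  shows "\<exists>\<phi>. is_lift X q m X T \<phi>"
proof -
  define u where "u x = 1 / m x" for x
  have contu: "continuous_on X u"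
    unfolding u_def using pos by (intro continuous_intros contm) force
  have u: "u x > 0" if "x \<in> X" for x
    using pos[OF that] by (simp add: u_def)
  have "\<exists>\<phi>. is_lift X q m {x \<in> X. u x \<le> real n + 1} T \<phi>" for n
  proof -
    have "{x \<in> X. m x \<ge> 1 / (real n + 1)} = {x \<in> X. u x \<le> real n + 1}"
      using pos by (force simp: u_def field_simps)
    then show ?thesis
      using ex[of "1 / (real n + 1)"] by simp
  qed
  then obtain \<psi> where \<psi>: "\<And>n. is_lift X q m {x \<in> X. u x \<le> real n + 1} T (\<psi> n)"
    by metis
  define step where "step n = (\<lambda>(x, t). \<psi> (Suc n) (\<psi> n (x, (real n + 1 - u x) * t), (u x - real n) * t))" for n
  define B where "B n = {x \<in> X. real n \<le> u x \<and> u x \<le> real n + 1}" for n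
  have step: "is_lift X q m (B n) T (step n)" for n
    unfolding step_def
  proof (rule compose_lifts[OF \<psi> \<psi> _ _ _ _ _ T])
    show "continuous_on (B n) (\<lambda>x. real n + 1 - u x)" "continuous_on (B n) (\<lambda>x. u x - real n)"
      by (auto intro!: continuous_intros continuous_on_subset[OF contu] simp: B_def)
    fix x t assume x: "x \<in> B n" and t: "\<bar>t\<bar> \<le> T"
    have bd: "\<bar>s * t\<bar> \<le> T" if "0 \<le> s" "s \<le> 1" for s
      using that t T mult_mono[of s 1 "\<bar>t\<bar>" T] by (simp add: abs_mult)
    have s: "\<bar>(real n + 1 - u x) * t\<bar> \<le> T" "\<bar>(u x - real n) * t\<bar> \<le> T"
      using x by (intro bd; simp add: B_def)+
    have "x \<in> {x \<in> X. u x \<le> real n + 1}"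
      using x by (simp add: B_def)
    from is_liftD(3,5)[OF \<psi> this s(1)] s x
    show "\<bar>(real n + 1 - u x) * t\<bar> \<le> T \<and> \<bar>(u x - real n) * t\<bar> \<le> T \<and>
        \<psi> n (x, (real n + 1 - u x) * t) \<in> {x \<in> X. u x \<le> real (Suc n) + 1}"
      by (auto simp: B_def u_def)
  qed (auto simp: B_def)
  define idx where "idx x = nat \<lfloor>u x\<rfloor>" for x
  have idx: "x \<in> B (idx x)" if "x \<in> X" for x
  proof -
    have "real_of_int \<lfloor>u x\<rfloor> \<le> u x" "u x < real_of_int \<lfloor>u x\<rfloor> + 1"
      by linarith+
    moreover have "real (nat \<lfloor>u x\<rfloor>) = real_of_int \<lfloor>u x\<rfloor>"
      using u[OF that] by simp
    ultimately show ?thesis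
      using that by (simp add: B_def idx_def)
  qed
  define \<Phi> where "\<Phi> z = step (idx (fst z)) z" for z
  have \<Phi>_eq: "\<Phi> z = step n z" if z: "fst z \<in> B n" "\<bar>snd z\<bar> \<le> T" for z n
  proof (cases "u (fst z) = real n + 1")
    case True
    obtain x t where [simp]: "z = (x, t)"
      by fastforce
    have X: "x \<in> X" and ux: "u x = real n + 1"
      using z True by (auto simp: B_def)
    then have "idx x = Suc n"
      by (simp add: idx_def floor_eq_iff nat_eq_iff)
    have 1: "\<psi> n (x, 0) = x"
      by (rule is_liftD(2)[OF \<psi>]) (use X ux in auto)
    have 2: "\<psi> (Suc n) (x, t) \<in> {x \<in> X. u x \<le> real (Suc (Suc n)) + 1}"
    proof -
      have "x \<in> {x \<in> X. u x \<le> real (Suc n) + 1}"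
        using X ux by auto
      from is_liftD(3,5)[OF \<psi> this] z ux show ?thesis
        by (auto simp: u_def)
    qed
    show ?thesis
      using is_liftD(2)[OF \<psi> 2] by (simp add: \<Phi>_def \<open>idx x = Suc n\<close> step_def ux 1)
  next
    case False
    then have "idx (fst z) = n"
      using z by (auto simp: B_def idx_def floor_eq_iff nat_eq_iff)
    then show ?thesis
      by (simp add: \<Phi>_def)
  qed
  \<comment> \<open>Only finitely many layers meet \<open>u \<le> n\<close>, so continuity follows by induction on \<open>n\<close>.\<close>
  let ?A = "\<lambda>n::nat. {x \<in> X. u x \<le> real n} \<times> {-T..T}"
  have contA: "continuous_on (?A n) \<Phi>" for n
  proof (induction n)
    case 0
    have "?A 0 = {}"
      using u by force
    then show ?case
      by (simp only: continuous_on_empty)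
  next
    case (Suc n)
    have A: "?A (Suc n) = ?A n \<union> B n \<times> {-T..T}"
      by (auto simp: B_def)
    have contu': "continuous_on (?A (Suc n)) (\<lambda>z. u (fst z))"
      by (rule continuous_on_compose2[OF contu]) (auto intro: continuous_intros)
    have "continuous_on (B n \<times> {-T..T}) \<Phi>"
      by (rule continuous_on_eq[OF is_liftD(1)[OF step]]) (auto simp: \<Phi>_eq abs_le_iff)
    moreover have "closedin (top_of_set (?A (Suc n))) (?A n)"
    proof -
      have "?A n = ?A (Suc n) \<inter> (\<lambda>z. u (fst z)) -` {..real n}"
        by auto
      then show ?thesis
        using continuous_closedin_preimage[OF contu' closed_atMost[of "real n"]] by (simp only:)
    qed
    moreover have "closedin (top_of_set (?A (Suc n))) (B n \<times> {-T..T})"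
    proof -
      have "B n \<times> {-T..T} = ?A (Suc n) \<inter> (\<lambda>z. u (fst z)) -` {real n..}"
        by (auto simp: B_def)
      then show ?thesis
        using continuous_closedin_preimage[OF contu' closed_atLeast[of "real n"]] by (simp only:)
    qed
    ultimately show ?case
      using Suc unfolding A by (intro continuous_on_Un_local)
  qed
  have "continuous_on (X \<times> {-T..T}) \<Phi>"
    unfolding continuous_on_eq_continuous_within
  proof
    fix z assume z: "z \<in> X \<times> {-T..T}"
    have contu': "continuous_on (X \<times> {-T..T}) (\<lambda>z. u (fst z))"
      by (rule continuous_on_compose2[OF contu]) (auto intro: continuous_intros)
    obtain n :: nat where n: "u (fst z) < real n"
      using reals_Archimedean2 by blast
    obtain O' where O': "open O'" "(X \<times> {-T..T}) \<inter> (\<lambda>z. u (fst z)) -` {..<real n} = (X \<times> {-T..T}) \<inter> O'"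
      using continuous_openin_preimage_gen[OF contu' open_lessThan[of "real n"]] by (auto simp: openin_open)
    then have "z \<in> O'"
      using z n by auto
    have "X \<times> {-T..T} \<inter> O' \<subseteq> ?A n"
      unfolding O'(2)[symmetric] by auto
    have "continuous (at z within X \<times> {-T..T} \<inter> O') \<Phi>"
      using continuous_on_subset[OF contA \<open>_ \<subseteq> ?A n\<close>] z \<open>z \<in> O'\<close>
      by (simp add: continuous_on_eq_continuous_within)
    moreover have "at z within X \<times> {-T..T} \<inter> O' = at z within X \<times> {-T..T}"
      by (rule at_within_nhd[OF \<open>z \<in> O'\<close> O'(1)]) auto
    ultimately show "continuous (at z within X \<times> {-T..T}) \<Phi>"
      by simp
  qed
  moreover have "\<Phi> (x, t) = step (idx x) (x, t)" for x t
    by (simp add: \<Phi>_def)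
  ultimately have "is_lift X q m X T \<Phi>"
    using is_liftD(2-5)[OF step idx] by (intro is_liftI) auto
  then show ?thesis
    by blast
qed

lemma exists_global_lift:
  fixes X :: "'a::metric_space set"
  assumes contm: "continuous_on X m" and pos: "\<And>x. x \<in> X \<Longrightarrow> m x > 0"
    and comp: "\<And>\<eta>. \<eta> > 0 \<Longrightarrow> compact {x \<in> X. m x \<ge> \<eta>}"
    and loc: "\<And>x. x \<in> X \<Longrightarrow> \<exists>r>0. \<exists>\<epsilon>>0. \<exists>\<phi>. is_lift X q m (X \<inter> ball x r) \<epsilon> \<phi>"
    and "T \<ge> 0"
  shows "\<exists>\<phi>. is_lift X q m X T \<phi>"
proof (rule glue_lifts[OF contm pos \<open>T \<ge> 0\<close>])
  fix \<eta> :: real assume "\<eta> > 0"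
  then obtain \<epsilon> \<phi> where "\<epsilon> > 0" "is_lift X q m {x \<in> X. m x \<ge> \<eta>} \<epsilon> \<phi>"
    using patch_lifts[OF comp[OF \<open>\<eta> > 0\<close>], of X m q] loc by auto
  then show "\<exists>\<phi>. is_lift X q m {x \<in> X. m x \<ge> \<eta>} T \<phi>"
    by (intro extend_lift) auto
qed

section \<open>Homotopy equivalences from lifts\<close>

text \<open>
  Moving for time \<open>\<alpha>\<close> and then back need not give the identity, as a lift is not a flow.  But moving
  for time \<open>s * \<alpha>\<close> and back preserves the fibre for every \<open>s\<close>, which connects that composition to the
  identity.
\<close>

lemma homotopy_eqv_rotated_fibre:
  fixes X :: "'a::metric_space set"
  assumes lift: "is_lift X q m X T \<phi>" and \<alpha>: "\<bar>\<alpha>\<bar> \<le> T"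
  shows "{x \<in> X. q x = c} homotopy_eqv {x \<in> X. q x = rot \<alpha> c}"
proof -
  note L = is_liftD[OF lift]
  have half: "continuous_map (top_of_set {x \<in> X. q x = c}) (top_of_set {x \<in> X. q x = rot \<beta> c}) (\<lambda>x. \<phi> (x, \<beta>)) \<and>
      homotopic_with_canon (\<lambda>_. True) {x \<in> X. q x = c} {x \<in> X. q x = c} ((\<lambda>x. \<phi> (x, - \<beta>)) \<circ> (\<lambda>x. \<phi> (x, \<beta>))) id"
    if \<beta>: "\<bar>\<beta>\<bar> \<le> T" for \<beta> c
  proof
    let ?M = "{x \<in> X. q x = c}"
    have "continuous_on ?M (\<lambda>x. \<phi> (x, \<beta>))"
      by (rule continuous_on_compose2[OF L(1)]) (use \<beta> in \<open>auto intro!: continuous_intros\<close>)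
    then show "continuous_map (top_of_set ?M) (top_of_set {x \<in> X. q x = rot \<beta> c}) (\<lambda>x. \<phi> (x, \<beta>))"
      using \<beta> L(3,4) by auto
    have bd: "\<bar>s * \<beta>\<bar> \<le> T" if "s \<in> {0..1}" for s
      using that \<beta> mult_mono[of s 1 "\<bar>\<beta>\<bar>" T] by (simp add: abs_mult)
    let ?H = "\<lambda>z. \<phi> (\<phi> (snd z, fst z * \<beta>), - (fst z * \<beta>))"
    have 1: "continuous_on ({0..1} \<times> ?M) (\<lambda>z. \<phi> (snd z, fst z * \<beta>))"
      by (rule continuous_on_compose2[OF L(1)]) (use bd in \<open>force intro!: continuous_intros simp: abs_le_iff\<close>)+
    have "continuous_on ({0..1} \<times> ?M) ?H"
      by (rule continuous_on_compose2[OF L(1)])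
        (use bd L(3) in \<open>force intro!: continuous_intros 1 simp: abs_le_iff\<close>)+
    moreover have "?H ` ({0..1} \<times> ?M) \<subseteq> ?M"
      using bd L(3,4) by auto
    ultimately have "homotopic_with_canon (\<lambda>_. True) ?M ?M id ((\<lambda>x. \<phi> (x, - \<beta>)) \<circ> (\<lambda>x. \<phi> (x, \<beta>)))"
      by (subst homotopic_with, simp, intro exI[of _ ?H])
        (use L(2) in \<open>auto simp: prod_topology_subtopology_eu simp flip: subtopology_Times\<close>)
    then show "homotopic_with_canon (\<lambda>_. True) ?M ?M ((\<lambda>x. \<phi> (x, - \<beta>)) \<circ> (\<lambda>x. \<phi> (x, \<beta>))) id"
      by (rule homotopic_with_symD)
  qed
  show ?thesis
    unfolding homotopy_equivalent_space_def
    using half[of \<alpha> c] half[of "- \<alpha>" "rot \<alpha> c"] \<alpha> by auto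
qed

text \<open>
  A set lying over an arc retracts onto a fibre by deformation: each point is turned back by its
  own angle \<open>a x\<close>, and the last hypothesis says that it does not leave \<open>A\<close> on the way.
\<close>

lemma homotopy_eqv_arc:
  fixes X :: "'a::metric_space set"
  assumes lift: "is_lift X q m X T \<phi>"
    and A: "A \<subseteq> X" "{x \<in> X. q x = c} \<subseteq> A"
    and a: "continuous_on A a" "\<And>x. x \<in> A \<Longrightarrow> \<bar>a x\<bar> \<le> T" "\<And>x. x \<in> A \<Longrightarrow> q x = rot (a x) c"
      "\<And>x. \<lbrakk>x \<in> A; q x = c\<rbrakk> \<Longrightarrow> a x = 0"
    and arc: "\<And>x y s. \<lbrakk>x \<in> A; y \<in> X; 0 \<le> s; s \<le> 1; q y = rot (s * a x) c\<rbrakk> \<Longrightarrow> y \<in> A"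
  shows "{x \<in> X. q x = c} homotopy_eqv A"
proof -
  note L = is_liftD[OF lift]
  let ?M = "{x \<in> X. q x = c}"
  let ?r = "\<lambda>x. \<phi> (x, - a x)"
  have bd: "\<bar>s * a x\<bar> \<le> T" if "s \<in> {0..1}" "x \<in> A" for s x
    using that a(2)[of x] mult_mono[of s 1 "\<bar>a x\<bar>" T] by (simp add: abs_mult)
  have r: "continuous_map (top_of_set A) (top_of_set ?M) ?r"
  proof -
    have "continuous_on A ?r"
      by (rule continuous_on_compose2[OF L(1)])
        (use A a(2) in \<open>force intro!: continuous_intros a(1) simp: abs_le_iff\<close>)+
    moreover have "?r ` A \<subseteq> ?M"
      using L(3,4) A a(2,3) by auto
    ultimately show ?thesis
      by auto
  qed
  have i: "continuous_map (top_of_set ?M) (top_of_set A) id"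
    using A by auto
  have "homotopic_with_canon (\<lambda>_. True) ?M ?M (?r \<circ> id) id"
  proof (rule homotopic_with_equal)
    show "continuous_map (top_of_set ?M) (top_of_set ?M) (?r \<circ> id)"
      using i r by (rule continuous_map_compose)
  qed (use A L(2) a(4) in auto)
  moreover have "homotopic_with_canon (\<lambda>_. True) A A id (id \<circ> ?r)"
  proof -
    let ?H = "\<lambda>z. \<phi> (snd z, - (fst z * a (snd z)))"
    have 1: "continuous_on ({0..1} \<times> A) (\<lambda>z. a (snd z))"
      by (rule continuous_on_compose2[OF a(1)]) (auto intro: continuous_intros)
    have "continuous_on ({0..1} \<times> A) ?H"
      by (rule continuous_on_compose2[OF L(1)])
        (use bd A in \<open>force intro!: continuous_intros 1 simp: abs_le_iff\<close>)+
    moreover have "\<phi> (x, - (s * a x)) \<in> A" if "s \<in> {0..1}" "x \<in> A" for s x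
    proof (rule arc[OF that(2)])
      show "\<phi> (x, - (s * a x)) \<in> X" "q (\<phi> (x, - (s * a x))) = rot ((1 - s) * a x) c"
        using L(3,4)[of x "- (s * a x)"] bd[OF that] A that a(3)[of x] by (auto simp: algebra_simps)
    qed (use that in auto)
    ultimately show ?thesis
      by (subst homotopic_with, simp, intro exI[of _ ?H])
        (use L(2) A in \<open>auto simp: prod_topology_subtopology_eu simp flip: subtopology_Times\<close>)
  qed
  ultimately show ?thesis
    unfolding homotopy_equivalent_space_def using r i homotopic_with_symD by blast
qed

section \<open>Continuously differentiable maps\<close>

text \<open>
  The derivative is carried along as an explicit function, so that the chain rule can be applied
  without choosing derivatives again.
\<close>

definition C1_on :: "'a::euclidean_space set \<Rightarrow> ('a \<Rightarrow> 'b::euclidean_space) \<Rightarrow> ('a \<Rightarrow> 'a \<Rightarrow> 'b) \<Rightarrow> bool" where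
  "C1_on U f D \<longleftrightarrow> (\<forall>x\<in>U. (f has_derivative D x) (at x)) \<and> (\<forall>v. continuous_on U (\<lambda>x. D x v))"

lemma Ck_on_imp_continuous_on:
  assumes "Ck_on k U f"
  shows "continuous_on U f"
  using assms by (cases k) (auto intro: differentiable_imp_continuous_on)

lemma Ck_on_imp_C1_on:
  assumes "Ck_on (Suc k) U f" "open U"
  shows "C1_on U f (\<lambda>x. frechet_derivative f (at x))"
proof -
  have "f differentiable at x" if "x \<in> U" for x
    using assms that differentiable_on_eq_differentiable_at by auto
  moreover have "continuous_on U (\<lambda>x. frechet_derivative f (at x) v)" for v
    using assms(1) by (intro Ck_on_imp_continuous_on[of k]) simp
  ultimately show ?thesis
    unfolding C1_on_def frechet_derivative_works by blast
qed

lemma C1_onD: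
  assumes "C1_on U f D"
  shows "x \<in> U \<Longrightarrow> (f has_derivative D x) (at x)"
    and "continuous_on U (\<lambda>x. D x v)"
    and "x \<in> U \<Longrightarrow> bounded_linear (D x)"
  using assms by (auto simp: C1_on_def has_derivative_bounded_linear)

lemma C1_on_imp_continuous_on:
  assumes "C1_on U f D"
  shows "continuous_on U f"
  using C1_onD(1)[OF assms] by (meson continuous_at_imp_continuous_on has_derivative_continuous)

lemma continuous_on_C1_derivative:
  fixes g :: "'c::t2_space \<Rightarrow> 'a::euclidean_space"
  assumes f: "C1_on U f D" and g: "continuous_on S g" "g ` S \<subseteq> U" and v: "continuous_on S v"
  shows "continuous_on S (\<lambda>x. D (g x) (v x))"
proof -
  have "continuous_on S (\<lambda>x. \<Sum>b\<in>Basis. (v x \<bullet> b) *\<^sub>R D (g x) b)"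
    by (intro continuous_intros v continuous_on_compose2[OF C1_onD(2)[OF f] g])
  moreover have "D (g x) (v x) = (\<Sum>b\<in>Basis. (v x \<bullet> b) *\<^sub>R D (g x) b)" if "x \<in> S" for x
  proof -
    have "linear (D (g x))"
      using C1_onD(3)[OF f] g that by (auto intro: bounded_linear.linear)
    then have "(\<Sum>b\<in>Basis. (v x \<bullet> b) *\<^sub>R D (g x) b) = D (g x) (\<Sum>b\<in>Basis. (v x \<bullet> b) *\<^sub>R b)"
      by (simp add: linear_sum linear_scale)
    then show ?thesis
      by (simp add: euclidean_representation)
  qed
  ultimately show ?thesis
    by (simp cong: continuous_on_cong)
qed

lemma C1_on_compose:
  assumes f: "C1_on U f Df" and g: "C1_on V g Dg" and "g ` V \<subseteq> U"
  shows "C1_on V (\<lambda>x. f (g x)) (\<lambda>x v. Df (g x) (Dg x v))"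
  unfolding C1_on_def
proof (intro conjI ballI allI)
  fix x assume "x \<in> V"
  then show "((\<lambda>x. f (g x)) has_derivative (\<lambda>v. Df (g x) (Dg x v))) (at x)"
    using diff_chain_at[OF C1_onD(1)[OF g] C1_onD(1)[OF f]] assms(3) by (auto simp: o_def)
next
  show "continuous_on V (\<lambda>x. Df (g x) (Dg x v))" for v
    by (rule continuous_on_C1_derivative[OF f C1_on_imp_continuous_on[OF g] assms(3) C1_onD(2)[OF g]])
qed

section \<open>Local sections of maps to the plane\<close>

definition det2 :: "real \<times> real \<Rightarrow> real \<times> real \<Rightarrow> real" where
  "det2 p q = fst p * snd q - snd p * fst q"

text \<open>
  The coefficient is that of the orthogonal projection to the line of \<open>p\<close>.
\<close>

lemma det2_zero_imp_scaleR:
  assumes "det2 p q = 0" "p \<noteq> 0"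
  shows "q = ((fst p * fst q + snd p * snd q) / (norm p)\<^sup>2) *\<^sub>R p"
proof -
  obtain a b c d where [simp]: "p = (a, b)" "q = (c, d)"
    by fastforce
  have eq: "a * d = b * c"
    using assms(1) by (simp add: det2_def)
  have "a\<^sup>2 + b\<^sup>2 \<noteq> 0"
    using assms(2) by (simp add: sum_power2_eq_zero_iff zero_prod_def)
  moreover have "c * (a\<^sup>2 + b\<^sup>2) = (a * c + b * d) * a" "d * (a\<^sup>2 + b\<^sup>2) = (a * c + b * d) * b"
    using eq by algebra+
  ultimately show ?thesis
    by (simp add: norm_Pair field_simps)
qed

lemma dim_ge_2_imp_det2:
  fixes S :: "(real \<times> real) set"
  assumes "dim S \<ge> 2"
  obtains p q where "p \<in> S" "q \<in> S" "det2 p q \<noteq> 0"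
proof (rule ccontr)
  note that_orig = that
  assume "\<not> thesis"
  then have neg: "det2 p q = 0" if "p \<in> S" "q \<in> S" for p q
    using that_orig that by blast
  have "S \<subseteq> span {p}" if "p \<in> S" "p \<noteq> 0" for p
    using det2_zero_imp_scaleR[OF neg[OF that(1)] that(2)]
    by (metis span_base span_scale singletonI subsetI)
  moreover have "\<not> S \<subseteq> {0}"
    using assms by (metis dim_eq_0 not_numeral_le_zero)
  ultimately obtain p where "S \<subseteq> span {p}"
    by blast
  then have "dim S \<le> card {p}"
    by (intro dim_le_card) auto
  with assms show False
    by simp
qed

text \<open>
  The preimage of \<open>e\<close> near \<open>y\<close> is sought in the affine plane \<open>y + span {w1, w2}\<close>, to which the
  derivative of \<open>h\<close> restricts as an isomorphism.  Treating \<open>y\<close> as a parameter, this is the inverse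
  function theorem for \<open>(y, s) \<mapsto> (y, h (y + A s))\<close>, with \<open>A\<close> the linear parametrization of the plane.
  Staying in this plane matters later: it keeps the solution in the linear slice that represents
  a submanifold in a chart.
\<close>

lemma local_sections:
  fixes h :: "'a::euclidean_space \<Rightarrow> real \<times> real"
  assumes h: "C1_on V h D" and V: "open V" "y0 \<in> V"
    and ind: "det2 (D y0 w1) (D y0 w2) \<noteq> 0"
  obtains N \<sigma> where "open N" "(y0, h y0) \<in> N" "continuous_on N \<sigma>"
    "\<And>y e. (y, e) \<in> N \<Longrightarrow> \<sigma> (y, e) \<in> V \<and> h (\<sigma> (y, e)) = e \<and> \<sigma> (y, e) - y \<in> span {w1, w2}"
    "\<And>y. (y, h y) \<in> N \<Longrightarrow> \<sigma> (y, h y) = y"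
proof -
  define A where "A s = fst s *\<^sub>R w1 + snd s *\<^sub>R w2" for s :: "real \<times> real"
  have A: "bounded_linear A"
    unfolding A_def by (intro bounded_linear_intros)
  have contA: "continuous_on S A" for S
    unfolding A_def by (intro continuous_intros)
  let ?g = "\<lambda>z::'a \<times> (real \<times> real). fst z + A (snd z)"
  let ?H = "\<lambda>z::'a \<times> (real \<times> real). (fst z, h (?g z))"
  define O' where "O' = ?g -` V"
  have contg: "continuous_on S ?g" for S
    unfolding A_def by (intro continuous_intros)
  have O': "open O'"
    unfolding O'_def using contg V(1) by (intro open_vimage)
  have O0: "(y0, 0) \<in> O'"
    using V(2) by (simp add: O'_def A_def)
  define H' where "H' z = Blinfun (\<lambda>v. (fst v, D (?g z) (?g v)))" for z
  have g_bl: "bounded_linear ?g"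
    unfolding A_def by (intro bounded_linear_intros)
  have H': "blinfun_apply (H' z) = (\<lambda>v. (fst v, D (?g z) (?g v)))" if "z \<in> O'" for z
  proof -
    have "bounded_linear (\<lambda>v. D (?g z) (?g v))"
      using bounded_linear_compose[OF C1_onD(3)[OF h] g_bl] that by (simp add: O'_def)
    then have "bounded_linear (\<lambda>v. (fst v, D (?g z) (?g v)))"
      by (intro bounded_linear_Pair bounded_linear_fst)
    then show ?thesis
      by (simp add: H'_def bounded_linear_Blinfun_apply)
  qed
  have der: "(?H has_derivative blinfun_apply (H' z)) (at z)" if "z \<in> O'" for z
  proof -
    have "(?g has_derivative ?g) (at z)"
      by (rule bounded_linear_imp_has_derivative[OF g_bl])
    then have "((\<lambda>z. h (?g z)) has_derivative (\<lambda>v. D (?g z) (?g v))) (at z)"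
      using diff_chain_at[of ?g ?g z h "D (?g z)"] C1_onD(1)[OF h] that by (simp add: O'_def o_def)
    then show ?thesis
      unfolding H'[OF that] by (intro has_derivative_Pair bounded_linear_imp_has_derivative bounded_linear_fst)
  qed
  have contH': "continuous_on O' H'"
  proof (rule continuous_on_blinfun_componentwise)
    fix i :: "'a \<times> (real \<times> real)"
    have "continuous_on O' (\<lambda>z. (fst i, D (?g z) (?g i)))"
      by (intro continuous_intros continuous_on_C1_derivative[OF h contg]) (auto simp: O'_def)
    then show "continuous_on O' (\<lambda>z. blinfun_apply (H' z) i)"
      by (simp add: H' cong: continuous_on_cong)
  qed
  define p1 p2 where "p1 = D y0 w1" and "p2 = D y0 w2"
  have lin: "linear (D y0)"
    using C1_onD(3)[OF h V(2)] by (rule bounded_linear.linear)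
  \<comment> \<open>Cramer's rule for the inverse of \<open>D y0 \<circ> A\<close>.\<close>
  define C where "C e = (det2 e p2 / det2 p1 p2, det2 p1 e / det2 p1 p2)" for e
  have C: "C (D y0 (A s)) = s" for s
  proof -
    have "det2 p1 p2 \<noteq> 0"
      using ind by (simp add: p1_def p2_def)
    moreover have "D y0 (A s) = fst s *\<^sub>R p1 + snd s *\<^sub>R p2"
      by (simp add: A_def p1_def p2_def linear_add[OF lin] linear_scale[OF lin])
    ultimately show ?thesis
      by (cases s) (simp add: C_def det2_def field_simps)
  qed
  have blC: "bounded_linear C"
    unfolding C_def det2_def divide_inverse by (intro bounded_linear_intros)
  define G where "G = Blinfun (\<lambda>v::'a \<times> (real \<times> real). (fst v, C (snd v - D y0 (fst v))))"
  have "bounded_linear (\<lambda>v::'a \<times> (real \<times> real). C (snd v - D y0 (fst v)))"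
    by (intro bounded_linear_compose[OF blC] bounded_linear_sub bounded_linear_snd
        bounded_linear_compose[OF C1_onD(3)[OF h V(2)]] bounded_linear_fst)
  then have "bounded_linear (\<lambda>v::'a \<times> (real \<times> real). (fst v, C (snd v - D y0 (fst v))))"
    by (intro bounded_linear_Pair bounded_linear_fst)
  then have G: "blinfun_apply G = (\<lambda>v. (fst v, C (snd v - D y0 (fst v))))"
    by (simp add: G_def bounded_linear_Blinfun_apply)
  have inv: "G o\<^sub>L H' (y0, 0) = id_blinfun"
  proof (rule blinfun_eqI)
    fix v :: "'a \<times> (real \<times> real)"
    have [simp]: "A 0 = 0"
      by (simp add: A_def)
    show "blinfun_apply (G o\<^sub>L H' (y0, 0)) v = blinfun_apply id_blinfun v"
      by (simp add: G H'[OF O0] linear_add[OF lin] C)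
  qed
  obtain U' V' g g' where U': "open U'" "U' \<subseteq> O'" "(y0, 0) \<in> U'" and V': "open V'" "?H (y0, 0) \<in> V'"
    and hom: "homeomorphism U' V' ?H g"
    by (rule inverse_function_theorem[OF O' der contH' O0 inv]) auto
  \<comment> \<open>The second condition makes the local injectivity of \<open>?H\<close> applicable to \<open>(y, 0)\<close>, which yields \<open>\<sigma> (y, h y) = y\<close>.\<close>
  define N where "N = V' \<inter> {z. (fst z, 0) \<in> U'}"
  define \<sigma> where "\<sigma> z = ?g (g z)" for z
  have A0: "A 0 = 0"
    by (simp add: A_def)
  show thesis
  proof
    have "open ((\<lambda>z::'a \<times> (real \<times> real). (fst z, 0)) -` U')"
      by (intro open_vimage U' continuous_intros)
    then show "open N"
      using V'(1) unfolding N_def vimage_def by (intro open_Int)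
    show "(y0, h y0) \<in> N"
      using V' U' by (simp add: N_def A0)
    have "continuous_on N g"
      using hom by (rule continuous_on_subset[OF homeomorphism_cont2]) (auto simp: N_def)
    then show "continuous_on N \<sigma>"
      unfolding \<sigma>_def by (rule continuous_on_compose2[OF contg[of UNIV]]) auto
  next
    fix y e assume "(y, e) \<in> N"
    then have e: "(y, e) \<in> V'"
      by (simp add: N_def)
    then have gU: "g (y, e) \<in> U'" and "?H (g (y, e)) = (y, e)"
      using hom by (auto simp: homeomorphism_def)
    then have 1: "fst (g (y, e)) = y" "h (\<sigma> (y, e)) = e"
      by (auto simp: \<sigma>_def)
    moreover have "\<sigma> (y, e) \<in> V"
      using gU U' by (auto simp: \<sigma>_def O'_def)
    moreover have "\<sigma> (y, e) - y \<in> span {w1, w2}"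
      using 1 by (simp add: \<sigma>_def A_def) (intro span_add span_scale span_base; simp)
    ultimately show "\<sigma> (y, e) \<in> V \<and> h (\<sigma> (y, e)) = e \<and> \<sigma> (y, e) - y \<in> span {w1, w2}"
      by blast
  next
    fix y assume "(y, h y) \<in> N"
    then have "(y, 0) \<in> U'"
      by (simp add: N_def)
    then have "g (?H (y, 0)) = (y, 0)"
      using hom by (auto simp: homeomorphism_def)
    then show "\<sigma> (y, h y) = y"
      by (simp add: \<sigma>_def A0)
  qed
qed

section \<open>Local sections on submanifolds\<close>

text \<open>
  In the chart a curve inside \<open>W\<close> runs in the subspace \<open>L\<close>, which is closed and so contains the
  velocity \<open>w\<close> of the curve; the inverse chart takes \<open>w\<close> back to \<open>v\<close>.
\<close>

lemma slice_tangent_space: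
  fixes \<phi> \<psi> :: "'a::euclidean_space \<Rightarrow> 'a"
  assumes U: "open U" "x0 \<in> U" and V: "open V"
    and hom: "homeomorphism U V \<phi> \<psi>"
    and \<phi>: "C1_on U \<phi> D\<phi>" and \<psi>: "C1_on V \<psi> D\<psi>"
    and L: "subspace L" "\<phi> ` (U \<inter> W) \<subseteq> L"
    and v: "v \<in> tangent_space W x0"
  obtains w where "w \<in> L" "D\<psi> (\<phi> x0) w = v"
proof
  have \<phi>d: "(\<phi> has_derivative D\<phi> x0) (at x0)"
    by (rule C1_onD(1)[OF \<phi> U(2)])
  have "\<phi> x0 \<in> V"
    using hom U(2) by (auto simp: homeomorphism_def)
  then have "(\<psi> \<circ> \<phi> has_derivative D\<psi> (\<phi> x0) \<circ> D\<phi> x0) (at x0)"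
    by (intro diff_chain_at \<phi>d C1_onD(1)[OF \<psi>])
  moreover have "(\<psi> \<circ> \<phi> has_derivative (\<lambda>u. u)) (at x0)"
    by (rule has_derivative_transform_within_open[OF has_derivative_ident U])
      (use hom in \<open>auto simp: homeomorphism_def\<close>)
  ultimately have "D\<psi> (\<phi> x0) \<circ> D\<phi> x0 = (\<lambda>u. u)"
    by (rule has_derivative_unique)
  then show "D\<psi> (\<phi> x0) (D\<phi> x0 v) = v"
    by (metis comp_apply)
  obtain e \<gamma> where e: "e > 0" "\<gamma> ` {-e<..<e} \<subseteq> W" and \<gamma>0: "\<gamma> 0 = x0"
    and \<gamma>d: "(\<gamma> has_vector_derivative v) (at 0)"
    using v unfolding tangent_space_def by blast
  have "((\<phi> \<circ> \<gamma>) has_vector_derivative D\<phi> x0 v) (at 0)"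
  proof -
    have "(\<phi> \<circ> \<gamma> has_derivative D\<phi> x0 \<circ> (\<lambda>r. r *\<^sub>R v)) (at 0)"
      using \<gamma>d \<phi>d by (intro diff_chain_at) (auto simp: has_vector_derivative_def \<gamma>0)
    then show ?thesis
      using linear_scale[OF bounded_linear.linear[OF C1_onD(3)[OF \<phi> U(2)]]]
      by (simp add: has_vector_derivative_def o_def)
  qed
  then have "((\<lambda>t. norm (\<phi> (\<gamma> t) - \<phi> x0 - t *\<^sub>R D\<phi> x0 v) / \<bar>t\<bar>) \<longlongrightarrow> 0) (at 0)"
    by (simp add: has_vector_derivative_def has_derivative_iff_norm \<gamma>0)
  moreover have "\<forall>\<^sub>F t in at 0. norm (\<phi> (\<gamma> t) - \<phi> x0 - t *\<^sub>R D\<phi> x0 v) / \<bar>t\<bar> =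
      norm ((1 / t) *\<^sub>R (\<phi> (\<gamma> t) - \<phi> x0) - D\<phi> x0 v)"
    unfolding eventually_at_filter
  proof (intro always_eventually allI impI)
    fix t :: real assume "t \<noteq> 0"
    then have "(1 / t) *\<^sub>R (\<phi> (\<gamma> t) - \<phi> x0) - D\<phi> x0 v = (1 / t) *\<^sub>R (\<phi> (\<gamma> t) - \<phi> x0 - t *\<^sub>R D\<phi> x0 v)"
      by (simp add: algebra_simps)
    then show "norm (\<phi> (\<gamma> t) - \<phi> x0 - t *\<^sub>R D\<phi> x0 v) / \<bar>t\<bar> =
      norm ((1 / t) *\<^sub>R (\<phi> (\<gamma> t) - \<phi> x0) - D\<phi> x0 v)"
      by simp
  qed
  ultimately have "((\<lambda>t. norm ((1 / t) *\<^sub>R (\<phi> (\<gamma> t) - \<phi> x0) - D\<phi> x0 v)) \<longlongrightarrow> 0) (at 0)"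
    by (rule Lim_transform_eventually)
  then have lim: "((\<lambda>t. (1 / t) *\<^sub>R (\<phi> (\<gamma> t) - \<phi> x0)) \<longlongrightarrow> D\<phi> x0 v) (at 0)"
    by (rule LIM_zero_cancel[OF tendsto_norm_zero_cancel])
  have "isCont \<gamma> 0"
    using \<gamma>d has_vector_derivative_continuous by blast
  then have "\<forall>\<^sub>F t in at 0. \<gamma> t \<in> U"
    using U \<gamma>0 by (metis isCont_def topological_tendstoD)
  moreover have "\<forall>\<^sub>F t in at 0. t \<in> {-e<..<e}"
    using e by (intro eventually_at_in_open') auto
  ultimately have "\<forall>\<^sub>F t in at 0. (1 / t) *\<^sub>R (\<phi> (\<gamma> t) - \<phi> x0) \<in> L"
  proof eventually_elim
    case (elim t)
    have "\<phi> (\<gamma> t) \<in> L"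
      using elim e(2) L(2) by blast
    moreover have "x0 \<in> W"
      using e \<gamma>0 by force
    then have "\<phi> x0 \<in> L"
      using U(2) L(2) by blast
    ultimately show ?case
      using L(1) by (simp add: subspace_diff subspace_scale)
  qed
  then show "D\<phi> x0 v \<in> L"
    by (rule Lim_in_closed_set[OF closed_subspace[OF L(1)] _ _ lim]) simp
qed

lemma smooth_submanifold_parametrization:
  fixes W :: "'a::euclidean_space set"
  assumes "smooth_submanifold d W" "x0 \<in> W"
  obtains U V and \<phi> \<psi> :: "'a \<Rightarrow> 'a" and D\<psi> L where
    "open U" "x0 \<in> U" "open V" "\<phi> x0 \<in> V" "continuous_on U \<phi>" "C1_on V \<psi> D\<psi>" "subspace L"
    "\<And>x. x \<in> U \<inter> W \<Longrightarrow> \<phi> x \<in> L \<and> \<psi> (\<phi> x) = x"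
    "\<And>y. y \<in> V \<inter> L \<Longrightarrow> \<psi> y \<in> W"
    "\<And>v. v \<in> tangent_space W x0 \<Longrightarrow> \<exists>w\<in>L. D\<psi> (\<phi> x0) w = v"
proof -
  obtain U V L and \<phi> \<psi> :: "'a \<Rightarrow> 'a" where U: "open U" "x0 \<in> U" and V: "open V"
    and hom: "homeomorphism U V \<phi> \<psi>" and smooth: "smooth_on U \<phi>" "smooth_on V \<psi>"
    and L: "subspace L" "\<phi> ` (U \<inter> W) = V \<inter> L"
    using assms(1)[unfolded smooth_submanifold_def, THEN bspec, OF assms(2)]
    by (elim exE conjE) (rule that)
  have \<phi>\<psi>: "\<And>x. x \<in> U \<Longrightarrow> \<phi> x \<in> V \<and> \<psi> (\<phi> x) = x"
    using hom by (auto simp: homeomorphism_def)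
  have \<phi>: "C1_on U \<phi> (\<lambda>x. frechet_derivative \<phi> (at x))"
    using U(1) smooth(1) by (intro Ck_on_imp_C1_on[of 0]) (simp_all add: smooth_on_def del: Ck_on.simps)
  have \<psi>: "C1_on V \<psi> (\<lambda>x. frechet_derivative \<psi> (at x))"
    using V smooth(2) by (intro Ck_on_imp_C1_on[of 0]) (simp_all add: smooth_on_def del: Ck_on.simps)
  show thesis
  proof (rule that[OF U V _ C1_on_imp_continuous_on[OF \<phi>] \<psi> L(1)])
    show "\<phi> x0 \<in> V"
      using U(2) \<phi>\<psi> by blast
    show "\<phi> x \<in> L \<and> \<psi> (\<phi> x) = x" if "x \<in> U \<inter> W" for x
      using that L(2) \<phi>\<psi> by blast
    show "\<psi> y \<in> W" if "y \<in> V \<inter> L" for y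
      using that \<phi>\<psi> unfolding L(2)[symmetric] by auto
    show "\<exists>w\<in>L. frechet_derivative \<psi> (at (\<phi> x0)) w = v" if v: "v \<in> tangent_space W x0" for v
    proof -
      have "\<phi> ` (U \<inter> W) \<subseteq> L"
        using L(2) by blast
      then show ?thesis
        by (rule slice_tangent_space[OF U V hom \<phi> \<psi> L(1) _ v]) blast
    qed
  qed
qed

text \<open>
  Where \<open>F\<close> has rank two on \<open>W\<close>, every value \<open>e\<close> near \<open>F x\<close> is attained at a point of \<open>W\<close> depending
  continuously on \<open>x\<close> and \<open>e\<close>.  With \<open>e\<close> a rotation of \<open>F x\<close> this turns \<open>F\<close> without changing its norm.
\<close>

lemma sections_of_submersion:
  fixes F :: "'a::euclidean_space \<Rightarrow> real \<times> real"
  assumes W: "smooth_submanifold d W" "x0 \<in> W" and F: "C1_on UNIV F DF"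
    and v: "v1 \<in> tangent_space W x0" "v2 \<in> tangent_space W x0" "det2 (DF x0 v1) (DF x0 v2) \<noteq> 0"
  obtains N \<sigma> where "open N" "(x0, F x0) \<in> N" "continuous_on N \<sigma>"
    "\<And>x e. \<lbrakk>x \<in> W; (x, e) \<in> N\<rbrakk> \<Longrightarrow> \<sigma> (x, e) \<in> W \<and> F (\<sigma> (x, e)) = e"
    "\<And>x. \<lbrakk>x \<in> W; (x, F x) \<in> N\<rbrakk> \<Longrightarrow> \<sigma> (x, F x) = x"
proof -
  obtain U V L D\<psi> and \<phi> \<psi> :: "'a \<Rightarrow> 'a" where U: "open U" "x0 \<in> U" and V: "open V" "\<phi> x0 \<in> V"
    and \<phi>: "continuous_on U \<phi>" and \<psi>: "C1_on V \<psi> D\<psi>" and L: "subspace L"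
    and UW: "\<And>x. x \<in> U \<inter> W \<Longrightarrow> \<phi> x \<in> L \<and> \<psi> (\<phi> x) = x"
    and VL: "\<And>y. y \<in> V \<inter> L \<Longrightarrow> \<psi> y \<in> W"
    and tangent: "\<And>v. v \<in> tangent_space W x0 \<Longrightarrow> \<exists>w\<in>L. D\<psi> (\<phi> x0) w = v"
    by (rule smooth_submanifold_parametrization[OF W]) blast
  obtain w1 w2 where w: "w1 \<in> L" "D\<psi> (\<phi> x0) w1 = v1" "w2 \<in> L" "D\<psi> (\<phi> x0) w2 = v2"
    using tangent v(1,2) by metis
  have \<psi>0: "\<psi> (\<phi> x0) = x0"
    using UW U(2) W(2) by blast
  have h: "C1_on V (\<lambda>y. F (\<psi> y)) (\<lambda>y u. DF (\<psi> y) (D\<psi> y u))"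
    using C1_on_compose[OF F \<psi>] by simp
  obtain N \<sigma> where N: "open N" "(\<phi> x0, F x0) \<in> N" and cont: "continuous_on N \<sigma>"
    and \<sigma>: "\<And>y e. (y, e) \<in> N \<Longrightarrow> \<sigma> (y, e) \<in> V \<and> F (\<psi> (\<sigma> (y, e))) = e \<and> \<sigma> (y, e) - y \<in> span {w1, w2}"
    and \<sigma>0: "\<And>y. (y, F (\<psi> y)) \<in> N \<Longrightarrow> \<sigma> (y, F (\<psi> y)) = y"
    by (rule local_sections[OF h V, of w1 w2]) (use w v \<psi>0 in auto)
  let ?c = "\<lambda>z. (\<phi> (fst z), snd z)"
  have contc: "continuous_on (U \<times> UNIV) ?c"
    by (intro continuous_intros continuous_on_compose2[OF \<phi>]) auto
  let ?N = "(U \<times> UNIV) \<inter> ?c -` N"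
  show thesis
  proof
    show "open ?N"
      using U by (intro continuous_open_preimage[OF contc _ N(1)] open_Times open_UNIV)
    show "(x0, F x0) \<in> ?N"
      using U N by simp
    have "continuous_on ?N (\<lambda>z. \<sigma> (?c z))"
      by (rule continuous_on_compose2[OF cont continuous_on_subset[OF contc]]) auto
    then show "continuous_on ?N (\<lambda>z. \<psi> (\<sigma> (?c z)))"
      by (rule continuous_on_compose2[OF C1_on_imp_continuous_on[OF \<psi>]]) (use \<sigma> in auto)
  next
    fix x e assume x: "x \<in> W" "(x, e) \<in> ?N"
    then have "(\<phi> x, e) \<in> N" "x \<in> U"
      by auto
    note s = \<sigma>[OF this(1)]
    have "\<phi> x \<in> L"
      using x UW by auto
    moreover have "span {w1, w2} \<subseteq> L"
      using w L by (intro span_minimal) auto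
    ultimately have "\<sigma> (\<phi> x, e) \<in> L"
      using s L by (metis diff_add_cancel subsetD subspace_add)
    then show "\<psi> (\<sigma> (?c (x, e))) \<in> W \<and> F (\<psi> (\<sigma> (?c (x, e)))) = e"
      using s VL by simp
  next
    fix x assume x: "x \<in> W" "(x, F x) \<in> ?N"
    then have "\<psi> (\<phi> x) = x"
      using UW by auto
    then show "\<psi> (\<sigma> (?c (x, F x))) = x"
      using \<sigma>0[of "\<phi> x"] x by simp
  qed
qed

lemma C1_on_exp_scaleR:
  assumes h: "C1_on V h D"
  shows "C1_on (V \<times> UNIV) (\<lambda>z. exp (snd z) *\<^sub>R h (fst z))
    (\<lambda>z v. exp (snd z) *\<^sub>R D (fst z) (fst v) + (snd v * exp (snd z)) *\<^sub>R h (fst z))"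
  unfolding C1_on_def
proof (intro conjI ballI allI)
  fix z assume "z \<in> V \<times> (UNIV :: real set)"
  then have z: "fst z \<in> V"
    by auto
  have 1: "((\<lambda>z. h (fst z)) has_derivative (\<lambda>v. D (fst z) (fst v))) (at z)"
    using diff_chain_at[OF bounded_linear_imp_has_derivative[OF bounded_linear_fst] C1_onD(1)[OF h z]]
    by (simp add: o_def)
  have 2: "((\<lambda>z. exp (snd z)) has_derivative (\<lambda>v. exp (snd z) * snd v)) (at z)"
    using has_derivative_exp[OF bounded_linear_imp_has_derivative[OF bounded_linear_snd, of "at z"]]
    by (simp add: mult.commute)
  from has_derivative_scaleR[OF 2 1]
  show "((\<lambda>z. exp (snd z) *\<^sub>R h (fst z)) has_derivative
      (\<lambda>v. exp (snd z) *\<^sub>R D (fst z) (fst v) + (snd v * exp (snd z)) *\<^sub>R h (fst z))) (at z)"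
    by (simp add: mult.commute)
next
  fix v
  show "continuous_on (V \<times> (UNIV :: real set))
      (\<lambda>z. exp (snd z) *\<^sub>R D (fst z) (fst v) + (snd v * exp (snd z)) *\<^sub>R h (fst z))"
    by (intro continuous_intros continuous_on_compose2[OF C1_on_imp_continuous_on[OF h]]
        continuous_on_compose2[OF C1_onD(2)[OF h]]) auto
qed

text \<open>
  Where only the direction of \<open>F\<close> is a submersion, only the ray of \<open>F\<close> can be prescribed.  An auxiliary
  variable \<open>\<rho>\<close> reduces this to two equations in two unknowns: at \<open>\<rho> = 0\<close> the map \<open>(y, \<rho>) \<mapsto> exp \<rho> * F (\<psi> y)\<close> has
  rank two, since its derivative in the direction of \<open>\<rho>\<close> is \<open>F\<close> itself and the hypothesis provides a
  derivative that is not parallel to \<open>F\<close>.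
\<close>

lemma sections_of_direction:
  fixes F :: "'a::euclidean_space \<Rightarrow> real \<times> real"
  assumes W: "smooth_submanifold d W" "x0 \<in> W" and F: "C1_on UNIV F DF"
    and v: "v \<in> tangent_space W x0" "det2 (F x0) (DF x0 v) \<noteq> 0"
  obtains N \<sigma> where "open N" "(x0, F x0) \<in> N" "continuous_on N \<sigma>"
    "\<And>x e. \<lbrakk>x \<in> W; (x, e) \<in> N\<rbrakk> \<Longrightarrow> \<sigma> (x, e) \<in> W \<and> (\<exists>r>0. F (\<sigma> (x, e)) = r *\<^sub>R e)"
    "\<And>x. \<lbrakk>x \<in> W; (x, F x) \<in> N\<rbrakk> \<Longrightarrow> \<sigma> (x, F x) = x"
proof -
  obtain U V L D\<psi> and \<phi> \<psi> :: "'a \<Rightarrow> 'a" where U: "open U" "x0 \<in> U" and V: "open V" "\<phi> x0 \<in> V"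
    and \<phi>: "continuous_on U \<phi>" and \<psi>: "C1_on V \<psi> D\<psi>" and L: "subspace L"
    and UW: "\<And>x. x \<in> U \<inter> W \<Longrightarrow> \<phi> x \<in> L \<and> \<psi> (\<phi> x) = x"
    and VL: "\<And>y. y \<in> V \<inter> L \<Longrightarrow> \<psi> y \<in> W"
    and tangent: "\<And>v. v \<in> tangent_space W x0 \<Longrightarrow> \<exists>w\<in>L. D\<psi> (\<phi> x0) w = v"
    by (rule smooth_submanifold_parametrization[OF W]) blast
  obtain w where w: "w \<in> L" "D\<psi> (\<phi> x0) w = v"
    using tangent v(1) by metis
  have \<psi>0: "\<psi> (\<phi> x0) = x0"
    using UW U(2) W(2) by blast
  let ?h = "\<lambda>z. exp (snd z) *\<^sub>R F (\<psi> (fst z))"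
  note h = C1_on_exp_scaleR[OF C1_on_compose[OF F \<psi> subset_UNIV]]
  have V': "open (V \<times> (UNIV :: real set))"
    using V(1) by (intro open_Times open_UNIV)
  have "linear (\<lambda>u. DF x0 (D\<psi> (\<phi> x0) u))"
    using C1_onD(3)[OF C1_on_compose[OF F \<psi> subset_UNIV], of "\<phi> x0"] V(2) \<psi>0
    by (simp add: bounded_linear.linear)
  then have lin0: "DF x0 (D\<psi> (\<phi> x0) 0) = 0"
    by (rule linear_0)
  obtain N \<sigma> where N: "open N" "((\<phi> x0, 0), F x0) \<in> N" and cont: "continuous_on N \<sigma>"
    and \<sigma>: "\<And>y e. (y, e) \<in> N \<Longrightarrow> \<sigma> (y, e) \<in> V \<times> UNIV \<and> ?h (\<sigma> (y, e)) = e \<and>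
      \<sigma> (y, e) - y \<in> span {(w, 0), (0, 1)}"
    and \<sigma>0: "\<And>y. (y, ?h y) \<in> N \<Longrightarrow> \<sigma> (y, ?h y) = y"
  proof (rule local_sections[OF h V', of "(\<phi> x0, 0)" "(w, 0)" "(0, 1)"])
    have "det2 (DF x0 v) (F x0) \<noteq> 0"
      using v(2) by (simp add: det2_def mult.commute)
    then show "det2
       (exp (snd (\<phi> x0, 0)) *\<^sub>R DF (\<psi> (fst (\<phi> x0, 0))) (D\<psi> (fst (\<phi> x0, 0)) (fst (w, 0))) +
        (snd (w, 0) * exp (snd (\<phi> x0, 0))) *\<^sub>R F (\<psi> (fst (\<phi> x0, 0))))
       (exp (snd (\<phi> x0, 0)) *\<^sub>R DF (\<psi> (fst (\<phi> x0, 0))) (D\<psi> (fst (\<phi> x0, 0)) (fst (0, 1))) +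
        (snd (0, 1) * exp (snd (\<phi> x0, 0))) *\<^sub>R F (\<psi> (fst (\<phi> x0, 0)))) \<noteq> 0"
      using \<psi>0 w lin0 by simp
  qed (use V \<psi>0 in auto)
  let ?c = "\<lambda>z. ((\<phi> (fst z), 0), snd z)"
  have contc: "continuous_on (U \<times> UNIV) ?c"
    by (intro continuous_intros continuous_on_compose2[OF \<phi>]) auto
  let ?N = "(U \<times> UNIV) \<inter> ?c -` N"
  show thesis
  proof
    show "open ?N"
      using U by (intro continuous_open_preimage[OF contc _ N(1)] open_Times open_UNIV)
    show "(x0, F x0) \<in> ?N"
      using U N by simp
    have "continuous_on ?N (\<lambda>z. \<sigma> (?c z))"
      by (rule continuous_on_compose2[OF cont continuous_on_subset[OF contc]]) auto
    then have "continuous_on ?N (\<lambda>z. fst (\<sigma> (?c z)))"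
      by (rule continuous_on_fst)
    then show "continuous_on ?N (\<lambda>z. \<psi> (fst (\<sigma> (?c z))))"
      by (rule continuous_on_compose2[OF C1_on_imp_continuous_on[OF \<psi>]]) (use \<sigma> in force)
  next
    fix x e assume x: "x \<in> W" "(x, e) \<in> ?N"
    then have "((\<phi> x, 0), e) \<in> N" "x \<in> U"
      by auto
    note s = \<sigma>[OF this(1)]
    have "\<phi> x \<in> L"
      using x UW by auto
    moreover have "span {(w, 0), (0, 1)} \<subseteq> L \<times> (UNIV :: real set)"
      using w L by (intro span_minimal subspace_Times subspace_UNIV) (auto simp: subspace_0)
    with s have "\<sigma> ((\<phi> x, 0), e) - (\<phi> x, 0) \<in> L \<times> UNIV"
      by blast
    then have "fst (\<sigma> ((\<phi> x, 0), e)) - \<phi> x \<in> L"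
      by (auto simp: mem_Times_iff)
    ultimately have "fst (\<sigma> ((\<phi> x, 0), e)) \<in> L"
      using L by (metis diff_add_cancel subspace_add)
    moreover have "F (\<psi> (fst (\<sigma> ((\<phi> x, 0), e)))) = exp (- snd (\<sigma> ((\<phi> x, 0), e))) *\<^sub>R e"
    proof -
      let ?y = "\<sigma> ((\<phi> x, 0), e)"
      have "exp (- snd ?y) *\<^sub>R e = exp (- snd ?y) *\<^sub>R ?h ?y"
        using s by simp
      then show ?thesis
        by (simp flip: exp_add)
    qed
    ultimately show "\<psi> (fst (\<sigma> (?c (x, e)))) \<in> W \<and> (\<exists>r>0. F (\<psi> (fst (\<sigma> (?c (x, e))))) = r *\<^sub>R e)"
      using s VL by (auto simp: mem_Times_iff intro!: exI[of _ "exp _"])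
  next
    fix x assume x: "x \<in> W" "(x, F x) \<in> ?N"
    then have "\<psi> (\<phi> x) = x"
      using UW by auto
    then show "\<psi> (fst (\<sigma> (?c (x, F x)))) = x"
      using \<sigma>0[of "(\<phi> x, 0)"] x by simp
  qed
qed

section \<open>Local lifts for the direction of a map to the plane\<close>

lemma unit_map_scaleR:
  assumes "F y = r *\<^sub>R e" "r > 0"
  shows "unit_map F y = e /\<^sub>R norm e"
  using assms by (simp add: unit_map_def)

text \<open>
  A continuous solution \<open>\<sigma> (x, e)\<close> of the equation \<open>F \<in> {r * e | r > 0}\<close> becomes a lift when \<open>e\<close> is
  taken to be the rotation of \<open>F x\<close> by the angle \<open>t\<close>.
\<close>

lemma local_lift_of_sections:
  fixes F :: "'a::euclidean_space \<Rightarrow> real \<times> real"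
  assumes contF: "continuous_on UNIV F"
    and N: "open N" "(x0, F x0) \<in> N" and cont: "continuous_on N \<sigma>"
    and \<sigma>: "\<And>x e. \<lbrakk>x \<in> W; (x, e) \<in> N\<rbrakk> \<Longrightarrow> \<sigma> (x, e) \<in> W \<and> (\<exists>r>0. F (\<sigma> (x, e)) = r *\<^sub>R e)"
    and \<sigma>0: "\<And>x. \<lbrakk>x \<in> W; (x, F x) \<in> N\<rbrakk> \<Longrightarrow> \<sigma> (x, F x) = x"
    and m: "\<And>x e. \<lbrakk>x \<in> W; (x, e) \<in> N; norm e = norm (F x)\<rbrakk> \<Longrightarrow> m (\<sigma> (x, e)) = m x"
  shows "\<exists>r>0. \<exists>\<epsilon>>0. \<exists>\<phi>. is_lift (W - zeros_in W F) (unit_map F) m ((W - zeros_in W F) \<inter> ball x0 r) \<epsilon> \<phi>"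
proof -
  let ?X = "W - zeros_in W F"
  let ?p = "\<lambda>z. (fst z, rot (snd z) (F (fst z)))"
  have contp: "continuous_on S ?p" for S
    by (intro continuous_intros continuous_on_compose2[OF contF]) auto
  have "open (?p -` N)"
    using contp N(1) by (intro open_vimage)
  moreover have "(x0, 0) \<in> ?p -` N"
    using N(2) by simp
  ultimately obtain A B where AB: "open A" "open B" "x0 \<in> A" "0 \<in> B" "A \<times> B \<subseteq> ?p -` N"
    by (rule open_prod_elim) auto
  obtain r where r: "r > 0" "ball x0 r \<subseteq> A"
    using AB open_contains_ball by blast
  obtain \<epsilon> where \<epsilon>: "\<epsilon> > 0" "cball 0 \<epsilon> \<subseteq> B"
    using AB open_contains_cball by blast
  have inN: "(x, rot t (F x)) \<in> N" if "x \<in> ?X \<inter> ball x0 r" "\<bar>t\<bar> \<le> \<epsilon>" for x t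
  proof -
    have "x \<in> A" "t \<in> B"
      using that r(2) \<epsilon>(2) by auto
    then show ?thesis
      using AB(5) by auto
  qed
  have "is_lift ?X (unit_map F) m (?X \<inter> ball x0 r) \<epsilon> (\<lambda>z. \<sigma> (?p z))"
  proof (rule is_liftI)
    show "continuous_on ((?X \<inter> ball x0 r) \<times> {-\<epsilon>..\<epsilon>}) (\<lambda>z. \<sigma> (?p z))"
      by (rule continuous_on_compose2[OF cont contp]) (use inN in \<open>auto simp: abs_le_iff\<close>)
  next
    fix x assume "x \<in> ?X \<inter> ball x0 r"
    then show "\<sigma> (?p (x, 0)) = x"
      using \<sigma>0[of x] inN[of x 0] \<epsilon> by auto
  next
    fix x t assume x: "x \<in> ?X \<inter> ball x0 r" and t: "\<bar>t\<bar> \<le> \<epsilon>"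
    then have "x \<in> W" "F x \<noteq> 0"
      by (auto simp: zeros_in_def)
    note s = \<sigma>[OF \<open>x \<in> W\<close> inN[OF x t]]
    then obtain r where r: "r > 0" "F (\<sigma> (x, rot t (F x))) = r *\<^sub>R rot t (F x)"
      by blast
    have "rot t (F x) \<noteq> 0"
      using \<open>F x \<noteq> 0\<close> norm_rot[of t "F x"] by (metis norm_eq_zero)
    then show "\<sigma> (?p (x, t)) \<in> ?X"
      using r s by (simp add: zeros_in_def)
    show "unit_map F (\<sigma> (?p (x, t))) = rot t (unit_map F x)"
      using unit_map_scaleR[where F = F and y = "\<sigma> (x, rot t (F x))", OF r(2,1)] by (simp add: unit_map_def rot_scaleR)
    show "m (\<sigma> (?p (x, t))) = m x"
      using m[OF \<open>x \<in> W\<close> inN[OF x t]] by simp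
  qed
  then show ?thesis
    using r \<epsilon> by blast
qed

text \<open>
  Normalization is constant along rays, so its derivative kills the radial direction.
\<close>

lemma frechet_derivative_unit_map_eq_0:
  assumes F: "(F has_derivative DF) (at x)" and "F x \<noteq> 0" "det2 (F x) (DF v) = 0"
  shows "frechet_derivative (unit_map F) (at x) v = 0"
proof -
  obtain k where k: "DF v = k *\<^sub>R F x"
    using det2_zero_imp_scaleR assms by blast
  have "((\<lambda>x. norm (F x)) has_derivative (\<lambda>u. DF u \<bullet> sgn (F x))) (at x)"
    using has_derivative_norm[OF assms(2)] diff_chain_at[OF F] by (force simp: o_def)
  from Deriv.has_derivative_inverse[OF _ this] 
  have "((\<lambda>x. inverse (norm (F x))) has_derivative
      (\<lambda>u. - (inverse (norm (F x)) * (DF u \<bullet> sgn (F x)) * inverse (norm (F x))))) (at x)"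
    using assms(2) by simp
  from has_derivative_scaleR[OF this F]
  have "(unit_map F has_derivative (\<lambda>u. inverse (norm (F x)) *\<^sub>R DF u +
      (- (inverse (norm (F x)) * (DF u \<bullet> sgn (F x)) * inverse (norm (F x)))) *\<^sub>R F x)) (at x)"
    by (simp add: unit_map_def[abs_def])
  from frechet_derivative_at[OF this]
  have "frechet_derivative (unit_map F) (at x) v = inverse (norm (F x)) *\<^sub>R DF v +
      (- (inverse (norm (F x)) * (DF v \<bullet> sgn (F x)) * inverse (norm (F x)))) *\<^sub>R F x"
    by (rule fun_cong[OF sym])
  moreover have "F x \<bullet> sgn (F x) = norm (F x)"
    using assms(2) by (simp add: sgn_div_norm power2_norm_eq_inner[symmetric] power2_eq_square)
  ultimately show ?thesis
    using assms(2) by (simp add: k)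
qed

lemma tangent_space_mono:
  assumes "S \<subseteq> W"
  shows "tangent_space S x \<subseteq> tangent_space W x"
  using assms unfolding tangent_space_def by blast

text \<open>
  The closure in Condition (a) is compact and misses the zeros of \<open>F\<close>, so the norm of \<open>F\<close> has a
  positive minimum on it.
\<close>

lemma condition_a_imp_radius:
  assumes "condition_a W F" "compact W" "continuous_on UNIV F"
  obtains \<delta> where "\<delta> > 0" "\<And>x. \<lbrakk>x \<in> W; F x \<noteq> 0; norm (F x) < \<delta>\<rbrakk> \<Longrightarrow> rank_on W F x \<ge> 2"
proof -
  let ?C = "closure (crit_F W F - zeros_in W F)"
  have "?C \<subseteq> W"
    by (rule closure_minimal[OF _ compact_imp_closed[OF assms(2)]]) (auto simp: crit_F_def)
  then have "compact ?C"
    using compact_Int_closed[OF assms(2), of ?C] by (simp add: Int_absorb1)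
  have nz: "F x \<noteq> 0" if "x \<in> ?C" for x
  proof
    assume "F x = 0"
    then have "x \<in> ?C \<inter> zeros_in W F"
      using that \<open>?C \<subseteq> W\<close> unfolding zeros_in_def by blast
    then show False
      using assms(1) unfolding condition_a_def by blast
  qed
  obtain \<delta> where \<delta>: "\<delta> > 0" "\<And>x. x \<in> ?C \<Longrightarrow> \<delta> \<le> norm (F x)"
  proof (cases "?C = {}")
    case True
    show thesis
      by (rule that[of 1]) (simp_all only: True empty_iff zero_less_one)
  next
    case False
    obtain y where "y \<in> ?C" "\<And>x. x \<in> ?C \<Longrightarrow> norm (F y) \<le> norm (F x)"
      using continuous_attains_inf[OF \<open>compact ?C\<close> False, of "\<lambda>x. norm (F x)"]
      using continuous_on_norm[OF continuous_on_subset[OF assms(3) subset_UNIV]] by blast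
    then show thesis
      using nz by (intro that[of "norm (F y)"]) simp_all
  qed
  show thesis
  proof (rule that[OF \<delta>(1)])
    fix x assume x: "x \<in> W" "F x \<noteq> 0" "norm (F x) < \<delta>"
    then have "x \<notin> ?C"
      using \<delta>(2) by force
    then have "x \<notin> crit_F W F - zeros_in W F"
      using closure_subset[of "crit_F W F - zeros_in W F"] by blast
    then show "rank_on W F x \<ge> 2"
      using x by (auto simp: crit_F_def zeros_in_def)
  qed
qed

text \<open>
  Points with \<open>norm (F x) < \<delta>\<close> are moved at constant norm of \<open>F\<close>.  At the other points the norm of \<open>F\<close>
  may change, but small lifts keep it above \<open>\<delta> / 2\<close>.  Truncating the norm at \<open>\<delta> / 2\<close> gives a function
  that is constant along both kinds of motion.
\<close>

lemma local_lifts: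
  fixes F :: "'a::euclidean_space \<Rightarrow> real \<times> real"
  assumes W: "smooth_submanifold d W" and F: "C1_on UNIV F DF"
    and b: "condition_b W F"
    and \<delta>: "\<delta> > 0" "\<And>x. \<lbrakk>x \<in> W; F x \<noteq> 0; norm (F x) < \<delta>\<rbrakk> \<Longrightarrow> rank_on W F x \<ge> 2"
    and x0: "x0 \<in> W - zeros_in W F"
  shows "\<exists>r>0. \<exists>\<epsilon>>0. \<exists>\<phi>. is_lift (W - zeros_in W F) (unit_map F) (\<lambda>x. min (norm (F x)) (\<delta> / 2))
    ((W - zeros_in W F) \<inter> ball x0 r) \<epsilon> \<phi>"
proof -
  note contF = C1_on_imp_continuous_on[OF F]
  have x0W: "x0 \<in> W" and nz: "F x0 \<noteq> 0"
    using x0 by (auto simp: zeros_in_def)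
  have DF: "frechet_derivative F (at x0) = DF x0"
    using frechet_derivative_at[OF C1_onD(1)[OF F, of x0]] by simp
  show ?thesis
  proof (cases "norm (F x0) < \<delta>")
    case True
    then have "dim (DF x0 ` tangent_space W x0) \<ge> 2"
      using \<delta>(2)[OF x0W nz] by (simp add: rank_on_def DF)
    then obtain p q where "p \<in> DF x0 ` tangent_space W x0" "q \<in> DF x0 ` tangent_space W x0" "det2 p q \<noteq> 0"
      by (rule dim_ge_2_imp_det2)
    then obtain v1 v2 where v: "v1 \<in> tangent_space W x0" "v2 \<in> tangent_space W x0"
        "det2 (DF x0 v1) (DF x0 v2) \<noteq> 0"
      by blast
    obtain N \<sigma> where N: "open N" "(x0, F x0) \<in> N" "continuous_on N \<sigma>"
      and \<sigma>: "\<And>x e. \<lbrakk>x \<in> W; (x, e) \<in> N\<rbrakk> \<Longrightarrow> \<sigma> (x, e) \<in> W \<and> F (\<sigma> (x, e)) = e"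
      and \<sigma>0: "\<And>x. \<lbrakk>x \<in> W; (x, F x) \<in> N\<rbrakk> \<Longrightarrow> \<sigma> (x, F x) = x"
      by (rule sections_of_submersion[OF W x0W F v]) blast
    show ?thesis
    proof (rule local_lift_of_sections[OF contF N _ \<sigma>0])
      fix x e assume "x \<in> W" "(x, e) \<in> N"
      then show "\<sigma> (x, e) \<in> W \<and> (\<exists>r>0. F (\<sigma> (x, e)) = r *\<^sub>R e)"
        using \<sigma>[of x e] by (auto intro!: exI[of _ 1])
      show "min (norm (F (\<sigma> (x, e)))) (\<delta> / 2) = min (norm (F x)) (\<delta> / 2)" if "norm e = norm (F x)"
        using \<sigma>[OF \<open>x \<in> W\<close> \<open>(x, e) \<in> N\<close>] that by simp
    qed
  next
    case False
    have "rank_on (W - zeros_in W F) (unit_map F) x0 \<noteq> 0"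
      using b x0 by (auto simp: condition_b_def crit_unit_map_def)
    then have "\<not> frechet_derivative (unit_map F) (at x0) ` tangent_space (W - zeros_in W F) x0 \<subseteq> {0}"
      unfolding rank_on_def dim_eq_0 .
    then obtain v where "v \<in> tangent_space (W - zeros_in W F) x0"
        "frechet_derivative (unit_map F) (at x0) v \<noteq> 0"
      by blast
    then have v: "v \<in> tangent_space W x0" "det2 (F x0) (DF x0 v) \<noteq> 0"
      using tangent_space_mono[of "W - zeros_in W F" W] frechet_derivative_unit_map_eq_0[OF C1_onD(1)[OF F]] nz
      by auto
    obtain N \<sigma> where N: "open N" "(x0, F x0) \<in> N" "continuous_on N \<sigma>"
      and \<sigma>: "\<And>x e. \<lbrakk>x \<in> W; (x, e) \<in> N\<rbrakk> \<Longrightarrow> \<sigma> (x, e) \<in> W \<and> (\<exists>r>0. F (\<sigma> (x, e)) = r *\<^sub>R e)"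
      and \<sigma>0: "\<And>x. \<lbrakk>x \<in> W; (x, F x) \<in> N\<rbrakk> \<Longrightarrow> \<sigma> (x, F x) = x"
      by (rule sections_of_direction[OF W x0W F v]) blast
    define N' where "N' = N \<inter> (\<lambda>z. norm (F (\<sigma> z))) -` {\<delta> / 2<..} \<inter> (\<lambda>z. norm (F (fst z))) -` {\<delta> / 2<..}"
    have "continuous_on N (\<lambda>z. norm (F (\<sigma> z)))"
      by (intro continuous_intros continuous_on_compose2[OF contF N(3)]) auto
    then have "open (N \<inter> (\<lambda>z. norm (F (\<sigma> z))) -` {\<delta> / 2<..})"
      using N(1) by (rule continuous_open_preimage) simp
    moreover have "open ((\<lambda>z. norm (F (fst z))) -` {\<delta> / 2<..} :: ('a \<times> real \<times> real) set)"
      by (intro open_vimage continuous_intros continuous_on_compose2[OF contF]) auto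
    ultimately have "open N'"
      unfolding N'_def by (rule open_Int)
    moreover have "(x0, F x0) \<in> N'"
      using N(2) False \<delta>(1) \<sigma>0[OF x0W N(2)] by (simp add: N'_def)
    moreover have "continuous_on N' \<sigma>"
      using N(3) by (rule continuous_on_subset) (auto simp: N'_def)
    ultimately show ?thesis
    proof (rule local_lift_of_sections[OF contF])
      show "min (norm (F (\<sigma> (x, e)))) (\<delta> / 2) = min (norm (F x)) (\<delta> / 2)" if "(x, e) \<in> N'" for x e
        using that by (auto simp: N'_def)
    qed (use \<sigma> \<sigma>0 in \<open>auto simp: N'_def\<close>)
  qed
qed

section \<open>The fibre and the two halves\<close>

text \<open>
  The sign \<open>s\<close> lets the two half planes be treated together: the arctangent is the angle measured
  from \<open>(s, 0)\<close>.
\<close>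

lemma unit_map_polar:
  fixes f1 f2 :: "'a \<Rightarrow> real"
  assumes "\<bar>s\<bar> = 1" "s * f1 x > 0"
  shows "unit_map (\<lambda>x. (f1 x, f2 x)) x = rot (arctan (f2 x / f1 x)) (s, 0)"
proof -
  define u where "u = f2 x / f1 x"
  have s: "s = 1 \<and> f1 x > 0 \<or> s = - 1 \<and> f1 x < 0"
    using assms by (auto simp: abs_if zero_less_mult_iff split: if_splits)
  then have nz: "f1 x \<noteq> 0"
    by auto
  have pos: "sqrt (1 + u\<^sup>2) > 0"
    by (simp add: add_pos_nonneg)
  have "(f1 x)\<^sup>2 + (f2 x)\<^sup>2 = (f1 x)\<^sup>2 * (1 + u\<^sup>2)"
    using nz by (simp add: u_def field_simps)
  then have "norm (f1 x, f2 x) = \<bar>f1 x\<bar> * sqrt (1 + u\<^sup>2)"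
    by (simp add: norm_Pair real_sqrt_mult)
  then have norm: "norm (f1 x, f2 x) = s * f1 x * sqrt (1 + u\<^sup>2)"
    using s by auto
  have f2: "f2 x = u * f1 x"
    using nz by (simp add: u_def)
  show ?thesis
    unfolding unit_map_def norm rot_def
    using s pos nz by (auto simp: cos_arctan sin_arctan f2 field_simps)
qed

lemma fibre_homotopy_eqv_half:
  fixes f1 f2 :: "'a::euclidean_space \<Rightarrow> real"
  assumes F: "F = (\<lambda>x. (f1 x, f2 x))" "continuous_on UNIV F" and s: "\<bar>s\<bar> = 1" and c: "norm c = 1"
    and lift: "is_lift (W - zeros_in W F) (unit_map F) m (W - zeros_in W F) (2 * pi) \<phi>"
  shows "fiber W F c homotopy_eqv {x \<in> W. s * f1 x > 0}"
proof -
  let ?X = "W - zeros_in W F" and ?A = "{x \<in> W. s * f1 x > 0}"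
  let ?M = "\<lambda>c. {x \<in> ?X. unit_map F x = c}"
  have contf: "continuous_on S f1" "continuous_on S f2" for S
    using continuous_on_subset[OF F(2), of S] by (auto simp: F(1) dest: continuous_on_fst continuous_on_snd)
  have ss: "s * s = 1"
    using s abs_mult_self_eq[of s] by simp
  have half: "?M (s, 0) homotopy_eqv ?A"
  proof (rule homotopy_eqv_arc[OF lift, where a = "\<lambda>x. arctan (f2 x / f1 x)"])
    show "?A \<subseteq> ?X"
      by (auto simp: zeros_in_def F(1) zero_prod_def)
    show "continuous_on ?A (\<lambda>x. arctan (f2 x / f1 x))"
      by (intro continuous_intros contf) auto
    show "\<bar>arctan (f2 x / f1 x)\<bar> \<le> 2 * pi" for x
      using arctan_bounded[of "f2 x / f1 x"] pi_gt_zero by (simp add: abs_le_iff)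
    show "unit_map F x = rot (arctan (f2 x / f1 x)) (s, 0)" if "x \<in> ?A" for x
      unfolding F(1) using that s by (intro unit_map_polar) auto
    have cx: "f1 x = norm (F x) * fst (unit_map F x) \<and> f2 x = norm (F x) * snd (unit_map F x) \<and> norm (F x) > 0"
      if "x \<in> ?X" for x
      using that by (auto simp: unit_map_def zeros_in_def F(1))
    show "?M (s, 0) \<subseteq> ?A"
    proof
      fix x assume x: "x \<in> ?M (s, 0)"
      then have "x \<in> ?X" "unit_map F x = (s, 0)"
        by auto
      then have "s * f1 x = norm (F x) * (s * s)" "norm (F x) > 0"
        using cx[of x] by auto
      then show "x \<in> ?A"
        using \<open>x \<in> ?X\<close> unfolding ss by simp
    qed
    show "arctan (f2 x / f1 x) = 0" if "x \<in> ?A" "unit_map F x = (s, 0)" for x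
      using that cx[of x] \<open>?A \<subseteq> ?X\<close> by auto
    fix x' y' :: 'a and t :: real
    assume x: "x' \<in> ?A" and y: "y' \<in> ?X" and t: "0 \<le> t" "t \<le> 1"
      and q: "unit_map F y' = rot (t * arctan (f2 x' / f1 x')) (s, 0)"
    let ?a = "arctan (f2 x' / f1 x')"
    have "\<bar>t * ?a\<bar> \<le> \<bar>?a\<bar>"
      using t by (simp add: abs_mult mult_left_le_one_le)
    moreover have "\<bar>?a\<bar> < pi / 2"
      using arctan_bounded[of "f2 x' / f1 x'"] by linarith
    ultimately have "cos (t * ?a) > 0"
      by (intro cos_gt_zero_pi) linarith+
    moreover have "s * f1 y' = norm (F y') * cos (t * ?a)"
      using cx[OF y] q ss by (simp add: rot_def mult.left_commute)
    moreover have "norm (F y') > 0"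
      using cx[OF y] by blast
    ultimately have "s * f1 y' > 0"
      by (simp only: mult_pos_pos)
    then show "y' \<in> ?A"
      using y by simp
  qed
  have M: "?M (1, 0) homotopy_eqv ?M e" if e: "norm e = 1" for e
  proof -
    obtain t where "\<bar>t\<bar> \<le> 2 * pi" "e = rot t (1, 0)"
      by (rule ex_rot[OF e])
    then show ?thesis
      using homotopy_eqv_rotated_fibre[OF lift, of t "(1, 0)"] by simp
  qed
  have "?M c homotopy_eqv ?M (1, 0)"
    using M[OF c] homotopy_equivalent_space_sym by blast
  also have "?M (1, 0) homotopy_eqv ?M (s, 0)"
    using s by (intro M) (simp add: norm_Pair)
  also have "?M (s, 0) homotopy_eqv ?A"
    by (rule half)
  finally show ?thesis
    by (simp add: fiber_def)
qed

theorem theorem3p11: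
  fixes n :: nat
    and W :: "(real ^ 'N) set"
    and f1 f2 :: "real ^ 'N \<Rightarrow> real"
    and F :: "real ^ 'N \<Rightarrow> real \<times> real"
    and c :: "real \<times> real"
  assumes "n - 1 \<ge> 2"
    and "smooth_submanifold (n - 1) W" and "compact W" and "semialgebraic W"
    and "F = (\<lambda>x. (f1 x, f2 x))"
    and "Ck_on 2 UNIV F" and "semialgebraic_map F"
    and "condition_a W F" and "condition_b W F"
    and "c \<in> sphere 0 1"
  shows "fiber W F c homotopy_eqv {x \<in> W. f1 x > 0} \<and>
         fiber W F c homotopy_eqv {x \<in> W. f1 x < 0}"
proof -
  have C1: "C1_on UNIV F (\<lambda>x. frechet_derivative F (at x))"
    using assms(6) by (intro Ck_on_imp_C1_on[of 1]) (simp_all add: numeral_2_eq_2)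
  note contF = C1_on_imp_continuous_on[OF C1]
  obtain \<delta> where \<delta>: "\<delta> > 0" "\<And>x. \<lbrakk>x \<in> W; F x \<noteq> 0; norm (F x) < \<delta>\<rbrakk> \<Longrightarrow> rank_on W F x \<ge> 2"
    by (rule condition_a_imp_radius[OF assms(8) assms(3) contF]) blast
  let ?X = "W - zeros_in W F" and ?m = "\<lambda>x. min (norm (F x)) (\<delta> / 2)"
  have contm: "continuous_on S ?m" for S
    by (intro continuous_intros continuous_on_subset[OF contF]) auto
  have "\<exists>\<phi>. is_lift ?X (unit_map F) ?m ?X (2 * pi) \<phi>"
  proof (rule exists_global_lift[OF contm])
    show "?m x > 0" if "x \<in> ?X" for x
      using that \<delta>(1) by (auto simp: zeros_in_def)
    show "compact {x \<in> ?X. ?m x \<ge> \<eta>}" if "\<eta> > 0" for \<eta>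
    proof -
      have "{x \<in> ?X. ?m x \<ge> \<eta>} = W \<inter> ?m -` {\<eta>..}"
        using that by (auto simp: zeros_in_def)
      moreover have "closed (?m -` {\<eta>..})"
        by (intro closed_vimage contm closed_atLeast)
      ultimately show ?thesis
        using assms(3) by (simp add: compact_Int_closed)
    qed
    show "\<exists>r>0. \<exists>\<epsilon>>0. \<exists>\<phi>. is_lift ?X (unit_map F) ?m (?X \<inter> ball x r) \<epsilon> \<phi>" if "x \<in> ?X" for x
      by (rule local_lifts[OF assms(2) C1 assms(9) \<delta> that])
  qed simp
  then obtain \<phi> where \<phi>: "is_lift ?X (unit_map F) ?m ?X (2 * pi) \<phi>"
    by blast
  have c: "norm c = 1"
    using assms(10) by simp
  show ?thesis
    using fibre_homotopy_eqv_half[OF assms(5) contF _ c \<phi>, of 1]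
      fibre_homotopy_eqv_half[OF assms(5) contF _ c \<phi>, of "- 1"] by simp
qed

end
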